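(* Let $v:\mathbb{R}^d\to\mathbb{R}^d$ be a Lipschitz vector field with $\nabla\cdot v=0$, with Lipschitz constant $\|v\|_{\mathrm{Lip}}$, let $\phi:\mathbb{R}_+\times\mathbb{R}^d\to\mathbb{R}^d$ be its flow ($\partial_t\phi=v(\phi)$, $\phi(0,x)=x$), and let $u$ be the solution of the transport equation $$\partial_t u-v\cdot\nabla u=0,\qquad u|_{t=0}=u_0,$$ given by composing $u_0$ with the (measure-preserving, bi-Lipschitz) flow map at time $t$. Then: (1) if $u_0\in\mathrm{BMO}$, then $u\in L^\infty_{loc}(\mathrm{BMO})$ and there is a constant $C$ depending only on $d$ such that $\|u(t)\|_{\mathrm{BMO}}\le C\,[1+\|v\|_{\mathrm{Lip}}\,t]\,\|u_0\|_{\mathrm{BMO}}$ for all $t\ge0$; (2) if $u_0\in\mathrm{Lip}_p(a)$ for some $a\in(0,1]$ and $p\in(1,\infty)$, then $u\in L^\infty_{loc}(\mathrm{Lip}_p(a))$ and there is a constant $C$ depending only on $d,p,a$ such that $\|u(t)\|_{\mathrm{Lip}_p(a)}\le C\,e^{a\|v\|_{\mathrm{Lip}}t}\,\|u_0\|_{\mathrm{Lip}_p(a)}$ for all $t\ge0$.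
   Context: For $p\in[1,\infty)$, $a\in[0,1]$, $f\in L^1_{loc}(\mathbb{R}^d)$, set $\|f\|^\sharp_{p,a}=\sup_B\left(|B|^{-1-ap/d}\int_B|f-\frac{1}{|B|}\int_Bf|^p\right)^{1/p}$ over balls $B$. $\mathrm{BMO}$ is the space where $\|f\|_{\mathrm{BMO}}:=\|f\|^\sharp_{1,0}<\infty$; $\mathrm{Lip}_p(a)$ ($a\in(0,1]$) is the space where $\|f\|_{\mathrm{Lip}_p(a)}:=\|f\|^\sharp_{p,a}<\infty$. Since $\nabla\cdot v=0$, each flow map $\phi(t,\cdot)$ is a Lebesgue-measure-preserving bi-Lipschitz homeomorphism of $\mathbb{R}^d$. *)

theory Defs
  imports "HOL-Analysis.Analysis"
begin

definition locally_integrable :: "('a::euclidean_space \<Rightarrow> real) \<Rightarrow> bool" where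
  "locally_integrable f \<longleftrightarrow> (\<forall>K. compact K \<longrightarrow> set_integrable lebesgue K f)"

definition ball_avg :: "('a::euclidean_space \<Rightarrow> real) \<Rightarrow> 'a set \<Rightarrow> real" where
  "ball_avg f B = (LINT y:B|lebesgue. f y) / measure lebesgue B"

definition osc_term :: "real \<Rightarrow> real \<Rightarrow> ('a::euclidean_space \<Rightarrow> real) \<Rightarrow> 'a \<Rightarrow> real \<Rightarrow> ereal" where
  "osc_term p a f x r =
    (let B = ball x r;
         I = (\<integral>\<^sup>+ y. indicator B y * ennreal (\<bar>f y - ball_avg f B\<bar> powr p) \<partial>lebesgue)
     in if I = \<infinity> then \<infinity>
        else ereal ((measure lebesgue B powr (-1 - a * p / real DIM('a)) * enn2real I) powr (1 / p)))"

definition sharp_norm :: "real \<Rightarrow> real \<Rightarrow> ('a::euclidean_space \<Rightarrow> real) \<Rightarrow> ereal" where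
  "sharp_norm p a f = (SUP xr \<in> UNIV \<times> {0<..}. osc_term p a f (fst xr) (snd xr))"

definition BMO_norm :: "('a::euclidean_space \<Rightarrow> real) \<Rightarrow> ereal" where
  "BMO_norm f = sharp_norm 1 0 f"

definition in_BMO :: "('a::euclidean_space \<Rightarrow> real) \<Rightarrow> bool" where
  "in_BMO f \<longleftrightarrow> locally_integrable f \<and> BMO_norm f < \<infinity>"

definition Lip_norm :: "real \<Rightarrow> real \<Rightarrow> ('a::euclidean_space \<Rightarrow> real) \<Rightarrow> ereal" where
  "Lip_norm p a f = sharp_norm p a f"

definition in_Lip :: "real \<Rightarrow> real \<Rightarrow> ('a::euclidean_space \<Rightarrow> real) \<Rightarrow> bool" where
  "in_Lip p a f \<longleftrightarrow> locally_integrable f \<and> Lip_norm p a f < \<infinity>"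

definition lip_norm :: "('a::euclidean_space \<Rightarrow> 'a) \<Rightarrow> real" where
  "lip_norm v = Inf {L. L-lipschitz_on UNIV v}"

text \<open>Distributional divergence-free condition: int v . grad psi = 0 for all C^1
  compactly supported test functions psi (psi' x is the derivative of psi at x).\<close>
definition divergence_free :: "('a::euclidean_space \<Rightarrow> 'a) \<Rightarrow> bool" where
  "divergence_free v \<longleftrightarrow>
     (\<forall>(\<psi>::'a \<Rightarrow> real) \<psi>'.
        (\<forall>x. (\<psi> has_derivative \<psi>' x) (at x)) \<longrightarrow>
        (\<forall>b. continuous_on UNIV (\<lambda>x. \<psi>' x b)) \<longrightarrow>
        (\<exists>K. compact K \<and> (\<forall>x. x \<notin> K \<longrightarrow> \<psi> x = 0)) \<longrightarrow>
        integral\<^sup>L lebesgue (\<lambda>x. \<psi>' x (v x)) = 0)"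

definition is_flow :: "('a::euclidean_space \<Rightarrow> 'a) \<Rightarrow> (real \<Rightarrow> 'a \<Rightarrow> 'a) \<Rightarrow> bool" where
  "is_flow v \<phi> \<longleftrightarrow>
     (\<forall>x. \<phi> 0 x = x) \<and>
     (\<forall>x t. 0 \<le> t \<longrightarrow> ((\<lambda>s. \<phi> s x) has_vector_derivative v (\<phi> t x)) (at t within {0..}))"

end

(* The flow is bi-Lipschitz by Gronwall. It preserves Lebesgue measure although v is only Lipschitz:
   for a Lipschitz, compactly supported G one step of length h changes the integral of G o phi_h
   by at most C h e + C_e h^2 for every e > 0, so that summing T/h steps and letting h, then e,
   tend to 0 shows that the integral is constant in time.

   For the oscillation of u = u0 o phi_t on a ball of radius r, put E = exp (L t). The image of
   the ball lies in a ball of radius R = E r, and is covered, with total volume comparable to that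
   of the ball, by balls of radius rho = r / E, because phi_t preserves volume and contracts at
   most by E. On each small ball u0 is close to its mean, and the means on scales rho and R differ
   by the sum of about log2 (R / rho) dyadic increments of size 2^(d+ja) N rho^a. For a = 0 this sum
   is O(1 + L t) N; for a > 0 it is geometric and dominated by R^a N = exp (a L t) r^a N. *)
theory Submission
  imports Defs
begin

subsection \<open>Lipschitz flows\<close>

text \<open>Two obstacles shape the argument. Functions transported by the flow are only Lipschitz,
  whereas \<open>divergence_free\<close> speaks of C^1 test functions. Instead of working with
  Jacobians that exist only almost everywhere, the derivative is put on an explicit C^1 kernel of
  radius e, and the error h e is the price for commuting the flow with translations of size e. For
  the seminorms, enclosing the image of a ball of radius r in one of radius E r and comparing
  volumes would cost a power of E, hence exponential growth in time even for BMO. Going down to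
  radius r / E costs only a dimensional factor; what remains is to compare means over a range of
  scales of ratio E^2 = exp (2 L t), and this costs one increment per doubling, so a number of
  increments linear in L t. A last point is measurability: u0 is only Lebesgue measurable, so the
  work is done on a Borel representative, and measure preservation carries almost-everywhere
  equality through the composition.\<close>

lemma lipschitz_ode_solutions_dist:
  fixes v :: "'a::euclidean_space \<Rightarrow> 'a"
  assumes lip: "L-lipschitz_on UNIV v"
    and \<alpha>: "\<And>s. 0 \<le> s \<Longrightarrow> (\<alpha> has_vector_derivative v (\<alpha> s)) (at s within {0..})"
    and \<beta>: "\<And>s. 0 \<le> s \<Longrightarrow> (\<beta> has_vector_derivative v (\<beta> s)) (at s within {0..})"
    and t: "0 \<le> t"
  shows "dist (\<alpha> t) (\<beta> t) \<le> exp (L * t) * dist (\<alpha> 0) (\<beta> 0)"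
    and "dist (\<alpha> 0) (\<beta> 0) \<le> exp (L * t) * dist (\<alpha> t) (\<beta> t)"
proof -
  define w where "w = (\<lambda>s. \<alpha> s - \<beta> s)"
  \<comment> \<open>The squared distance is differentiable also where the two solutions meet, unlike
    the distance itself.\<close>
  define q where "q = (\<lambda>s. w s \<bullet> w s)"
  define q' where "q' = (\<lambda>s. 2 * (w s \<bullet> (v (\<alpha> s) - v (\<beta> s))))"
  have q'_bound: "\<bar>q' s\<bar> \<le> 2 * L * q s" for s
  proof -
    have "\<bar>w s \<bullet> (v (\<alpha> s) - v (\<beta> s))\<bar> \<le> norm (w s) * norm (v (\<alpha> s) - v (\<beta> s))"
      by (rule Cauchy_Schwarz_ineq2)
    also have "\<dots> \<le> norm (w s) * (L * norm (w s))"
      using lipschitz_onD[OF lip, of "\<alpha> s" "\<beta> s"]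
      by (intro mult_left_mono) (auto simp: dist_norm w_def)
    finally show ?thesis
      by (simp add: q'_def q_def power2_norm_eq_inner[symmetric] power2_eq_square algebra_simps)
  qed
  have q_deriv_within: "(q has_real_derivative q' s) (at s within {0..})" if "0 \<le> s" for s
  proof -
    have "(w has_vector_derivative (v (\<alpha> s) - v (\<beta> s))) (at s within {0..})"
      unfolding w_def by (intro has_vector_derivative_diff \<alpha> \<beta> that)
    then have "(w has_derivative (\<lambda>h. h *\<^sub>R (v (\<alpha> s) - v (\<beta> s)))) (at s within {0..})"
      by (simp add: has_vector_derivative_def)
    from has_derivative_inner[OF this this]
    have "(q has_derivative (\<lambda>h. h * q' s)) (at s within {0..})"
      unfolding q_def q'_def
      by (rule has_derivative_eq_rhs) (auto simp: inner_commute algebra_simps)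
    then show ?thesis
      by (simp add: has_field_derivative_def mult.commute[of _ "q' s"])
  qed
  have q_cont: "continuous_on {0..t} q"
    by (rule DERIV_continuous_on[where D = q'], rule DERIV_subset[OF q_deriv_within]) auto
  have q_deriv: "(q has_real_derivative q' s) (at s)" if "0 < s" for s
    using q_deriv_within[of s] that at_within_interior[of s "{0..}"] by simp
  \<comment> \<open>Since |q'| <= 2 L q, the weight exp (- 2 L s) makes q decreasing and the weight
    exp (2 L s) makes it increasing; the second is the backward estimate. At 0 only a one-sided
    derivative is available, so monotonicity is taken from the open interval and continuity.\<close>
  have "q t * exp (- 2 * L * t) \<le> q 0 * exp (- 2 * L * 0)"
  proof (rule DERIV_nonpos_imp_decreasing_open[OF t])
    fix s :: real assume s: "0 < s" "s < t"
    have "((\<lambda>s. q s * exp (- 2 * L * s)) has_real_derivative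
        (q' s - 2 * L * q s) * exp (- 2 * L * s)) (at s)"
      using q_deriv[OF s(1)] by (auto intro!: derivative_eq_intros simp: algebra_simps)
    moreover have "(q' s - 2 * L * q s) * exp (- 2 * L * s) \<le> 0"
      using q'_bound[of s] by (intro mult_nonpos_nonneg) auto
    ultimately show "\<exists>y. ((\<lambda>s. q s * exp (- 2 * L * s)) has_real_derivative y) (at s) \<and> y \<le> 0"
      by blast
  qed (intro continuous_intros q_cont)
  then have up: "q t \<le> (exp (L * t))\<^sup>2 * q 0"
    by (simp add: exp_minus field_simps power2_eq_square mult_exp_exp)
  have "q 0 * exp (2 * L * 0) \<le> q t * exp (2 * L * t)"
  proof (rule DERIV_nonneg_imp_increasing_open[OF t])
    fix s :: real assume s: "0 < s" "s < t"
    have "((\<lambda>s. q s * exp (2 * L * s)) has_real_derivative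
        (q' s + 2 * L * q s) * exp (2 * L * s)) (at s)"
      using q_deriv[OF s(1)] by (auto intro!: derivative_eq_intros simp: algebra_simps)
    moreover have "(q' s + 2 * L * q s) * exp (2 * L * s) \<ge> 0"
      using q'_bound[of s] by (intro mult_nonneg_nonneg) auto
    ultimately show "\<exists>y. ((\<lambda>s. q s * exp (2 * L * s)) has_real_derivative y) (at s) \<and> y \<ge> 0"
      by blast
  qed (intro continuous_intros q_cont)
  then have low: "q 0 \<le> (exp (L * t))\<^sup>2 * q t"
    by (simp add: field_simps power2_eq_square mult_exp_exp)
  have qd: "q s = (dist (\<alpha> s) (\<beta> s))\<^sup>2" for s
    by (simp add: q_def w_def dist_norm power2_norm_eq_inner)
  show "dist (\<alpha> t) (\<beta> t) \<le> exp (L * t) * dist (\<alpha> 0) (\<beta> 0)"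
    using up unfolding qd power_mult_distrib[symmetric] by (rule power2_le_imp_le) simp
  show "dist (\<alpha> 0) (\<beta> 0) \<le> exp (L * t) * dist (\<alpha> t) (\<beta> t)"
    using low unfolding qd power_mult_distrib[symmetric] by (rule power2_le_imp_le) simp
qed

locale lipschitz_flow =
  fixes v :: "'a::euclidean_space \<Rightarrow> 'a" and \<phi> :: "real \<Rightarrow> 'a \<Rightarrow> 'a" and L :: real
  assumes lip: "L-lipschitz_on UNIV v" and flow: "is_flow v \<phi>"
begin

lemma L_nonneg: "0 \<le> L"
  using lip lipschitz_on_nonneg by blast

lemma flow_0 [simp]: "\<phi> 0 x = x"
  using flow by (simp add: is_flow_def)

lemma flow_deriv: "0 \<le> t \<Longrightarrow> ((\<lambda>s. \<phi> s x) has_vector_derivative v (\<phi> t x)) (at t within {0..})"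
  using flow by (simp add: is_flow_def)

lemma flow_dist_le: "0 \<le> t \<Longrightarrow> dist (\<phi> t x) (\<phi> t y) \<le> exp (L * t) * dist x y"
  and flow_dist_ge: "0 \<le> t \<Longrightarrow> dist x y \<le> exp (L * t) * dist (\<phi> t x) (\<phi> t y)"
  using lipschitz_ode_solutions_dist[OF lip flow_deriv[of _ x] flow_deriv[of _ y], of t] by auto

text \<open>The equation is autonomous, so both sides solve it in t with the same value at 0, and
  the forward distance estimate with initial distance 0 gives uniqueness.\<close>

lemma flow_add:
  assumes "0 \<le> s" "0 \<le> t"
  shows "\<phi> (s + t) x = \<phi> t (\<phi> s x)"
proof -
  have shifted: "((\<lambda>r. \<phi> (s + r) x) has_vector_derivative v (\<phi> (s + r) x)) (at r within {0..})"
    if "0 \<le> r" for r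
  proof -
    have "((\<lambda>r. \<phi> r x) has_vector_derivative v (\<phi> (s + r) x)) (at (s + r) within {0..})"
      using assms that by (intro flow_deriv) auto
    then have *: "((\<lambda>r. \<phi> r x) has_vector_derivative v (\<phi> (s + r) x)) (at (s + r) within (\<lambda>r. s + r) ` {0..})"
      by (rule has_vector_derivative_within_subset) (use assms in auto)
    have "((\<lambda>r. s + r) has_vector_derivative 1) (at r within {0..})"
      by (auto intro!: derivative_eq_intros)
    from vector_diff_chain_within[OF this *] show ?thesis
      by (simp add: o_def)
  qed
  have "dist (\<phi> (s + t) x) (\<phi> t (\<phi> s x)) \<le> exp (L * t) * dist (\<phi> (s + 0) x) (\<phi> 0 (\<phi> s x))"
    by (rule lipschitz_ode_solutions_dist(1)[OF lip shifted flow_deriv assms(2)])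
  then show ?thesis by simp
qed

lemma flow_continuous: "0 \<le> t \<Longrightarrow> continuous_on A (\<phi> t)"
  by (rule lipschitz_on_continuous_on[where L = "exp (L * t)"])
     (auto simp: lipschitz_on_def flow_dist_le)

lemma flow_measurable: "0 \<le> t \<Longrightarrow> \<phi> t \<in> borel_measurable borel"
  by (intro borel_measurable_continuous_onI flow_continuous)

lemma flow_continuous_time: "continuous_on {0..} (\<lambda>s. \<phi> s x)"
  by (auto simp: continuous_on_eq_continuous_within intro!: has_vector_derivative_continuous flow_deriv)

text \<open>Mean value inequality for the map taking s to \<phi> s x - s w. With w = 0 it bounds the
  displacement by the speed; with w = v x it gives the quadratic error of one Euler step.\<close>

lemma flow_increment_bound:
  assumes h: "0 \<le> h" and bd: "\<And>s. 0 \<le> s \<Longrightarrow> s \<le> h \<Longrightarrow> norm (v (\<phi> s x) - w) \<le> K"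
  shows "norm (\<phi> h x - x - h *\<^sub>R w) \<le> K * h"
proof -
  have "norm ((\<phi> h x - h *\<^sub>R w) - (\<phi> 0 x - 0 *\<^sub>R w)) \<le> K * norm (h - 0)"
  proof (rule differentiable_bound[where S = "{0..h}" and f' = "\<lambda>s r. r *\<^sub>R (v (\<phi> s x) - w)"])
    fix s assume s: "s \<in> {0..h}"
    have "((\<lambda>s. \<phi> s x) has_vector_derivative v (\<phi> s x)) (at s within {0..h})"
      using flow_deriv[of s x] s by (auto intro: has_vector_derivative_within_subset)
    then show "((\<lambda>s. \<phi> s x - s *\<^sub>R w) has_derivative (\<lambda>r. r *\<^sub>R (v (\<phi> s x) - w))) (at s within {0..h})"
      unfolding has_vector_derivative_def by (auto intro!: derivative_eq_intros simp: algebra_simps)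
    show "onorm (\<lambda>r. r *\<^sub>R (v (\<phi> s x) - w)) \<le> K"
      using bd[of s] s by (intro onorm_le) (auto simp: mult.commute[of K] intro!: mult_left_mono)
  qed (use h in auto)
  then show ?thesis using h by (simp add: algebra_simps)
qed

text \<open>The gain is the factor h: the displacement, as opposed to the flow map, has a Lipschitz
  constant proportional to the time step, so errors of this kind can be summed over T / h steps. The
  bound h <= 1 only replaces exp (L h) by exp L.\<close>

lemma flow_increment_diff:
  assumes "0 \<le> h" "h \<le> 1"
  shows "norm ((\<phi> h x - x) - (\<phi> h y - y)) \<le> L * exp L * h * norm (x - y)"
proof -
  have "norm ((\<phi> h x - \<phi> h y) - (\<phi> 0 x - \<phi> 0 y)) \<le> (L * exp L * norm (x - y)) * norm (h - 0)"
  proof (rule differentiable_bound[where S = "{0..h}" and f' = "\<lambda>s r. r *\<^sub>R (v (\<phi> s x) - v (\<phi> s y))"])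
    fix s assume s: "s \<in> {0..h}"
    have "((\<lambda>s. \<phi> s x) has_vector_derivative v (\<phi> s x)) (at s within {0..h})" for x
      using flow_deriv[of s x] s by (auto intro: has_vector_derivative_within_subset)
    from this[of x] this[of y]
    show "((\<lambda>s. \<phi> s x - \<phi> s y) has_derivative (\<lambda>r. r *\<^sub>R (v (\<phi> s x) - v (\<phi> s y)))) (at s within {0..h})"
      unfolding has_vector_derivative_def by (auto intro!: derivative_eq_intros simp: algebra_simps)
    have "norm (v (\<phi> s x) - v (\<phi> s y)) \<le> L * dist (\<phi> s x) (\<phi> s y)"
      using lipschitz_onD[OF lip, of "\<phi> s x" "\<phi> s y"] by (simp add: dist_norm)
    also have "\<dots> \<le> L * (exp (L * s) * dist x y)"
      using s L_nonneg by (intro mult_left_mono flow_dist_le) auto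
    also have "\<dots> \<le> L * (exp L * dist x y)"
      using s assms L_nonneg mult_left_mono[of s 1 L] by (intro mult_left_mono mult_right_mono) auto
    finally show "onorm (\<lambda>r. r *\<^sub>R (v (\<phi> s x) - v (\<phi> s y))) \<le> L * exp L * norm (x - y)"
      by (intro onorm_le) (auto simp: mult.commute mult.left_commute dist_norm intro!: mult_left_mono)
  qed (use assms in auto)
  then show ?thesis using assms by (simp add: algebra_simps)
qed

end

subsection \<open>A compactly supported test function\<close>

lemma integrable_bounded_support:
  fixes f :: "'a::euclidean_space \<Rightarrow> real"
  assumes [measurable]: "f \<in> borel_measurable borel"
    and bd: "\<And>x. \<bar>f x\<bar> \<le> K" and supp: "\<And>x. x \<notin> cball 0 R \<Longrightarrow> f x = 0"
  shows "integrable lborel f"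
    and "\<bar>integral\<^sup>L lborel f\<bar> \<le> K * measure lborel (cball (0::'a) R)"
proof -
  have fin: "emeasure lborel (cball (0::'a) R) < \<infinity>"
    by (rule emeasure_bounded_finite) auto
  show int: "integrable lborel f"
    by (rule integrableI_bounded_set[where A = "cball 0 R" and B = K]) (use fin bd supp in auto)
  have "\<bar>integral\<^sup>L lborel f\<bar> \<le> (\<integral>x. \<bar>f x\<bar> \<partial>lborel)"
    using integral_norm_bound[of lborel f] by simp
  also have "\<dots> \<le> (\<integral>x. K * indicator (cball (0::'a) R) x \<partial>lborel)"
  proof (rule Bochner_Integration.integral_mono)
    show "integrable lborel (\<lambda>x. \<bar>f x\<bar>)" using int by simp
    show "integrable lborel (\<lambda>x. K * indicator (cball (0::'a) R) x :: real)"
      using fin by (simp add: less_top)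
    show "\<bar>f x\<bar> \<le> K * indicator (cball (0::'a) R) x" for x
      using bd[of x] supp[of x] by (cases "x \<in> cball 0 R") (auto simp del: mem_cball)
  qed
  finally show "\<bar>integral\<^sup>L lborel f\<bar> \<le> K * measure lborel (cball (0::'a) R)" by simp
qed

lemma integral_lborel_translate:
  fixes f :: "'a::euclidean_space \<Rightarrow> real"
  assumes [measurable]: "f \<in> borel_measurable borel"
  shows "(\<integral>x. f (c + x) \<partial>lborel) = (\<integral>x. f x \<partial>lborel)"
proof -
  have "(\<integral>x. f x \<partial>lborel) = (\<integral>x. f x \<partial>distr lborel borel ((+) c))"
    by (simp add: lborel_distr_plus)
  also have "\<dots> = (\<integral>x. f (c + x) \<partial>lborel)"
    by (rule integral_distr) auto
  finally show ?thesis by simp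
qed

text \<open>Squaring the truncated paraboloid makes it C^1 across the sphere of radius e, which is
  the regularity asked for in \<open>divergence_free\<close>, and leaves an explicit quadratic
  Taylor remainder. It is not normalised; its integral appears later as a divisor.\<close>

definition bump :: "real \<Rightarrow> 'a::euclidean_space \<Rightarrow> real" where
  "bump e z = (max 0 (e\<^sup>2 - z \<bullet> z))\<^sup>2"

definition bump_deriv :: "real \<Rightarrow> 'a::euclidean_space \<Rightarrow> 'a \<Rightarrow> real" where
  "bump_deriv e z w = - 4 * max 0 (e\<^sup>2 - z \<bullet> z) * (z \<bullet> w)"

lemma bump_nonneg: "0 \<le> bump e z"
  by (simp add: bump_def)

lemma max_diff_sq_eq_0:
  assumes "0 \<le> e" "norm z > e" shows "max 0 (e\<^sup>2 - z \<bullet> z) = 0"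
proof -
  have "e\<^sup>2 \<le> (norm z)\<^sup>2" using assms by (intro power_mono) auto
  then show ?thesis by (simp add: power2_norm_eq_inner)
qed

lemma bump_eq_0: "0 \<le> e \<Longrightarrow> norm z > e \<Longrightarrow> bump e z = 0"
  by (simp add: bump_def max_diff_sq_eq_0)

lemma bump_deriv_eq_0: "0 \<le> e \<Longrightarrow> norm z > e \<Longrightarrow> bump_deriv e z w = 0"
  by (simp add: bump_deriv_def max_diff_sq_eq_0)

lemma bump_le_1: assumes "0 \<le> e" "e \<le> 1" shows "bump e z \<le> 1"
proof -
  have "e\<^sup>2 \<le> 1" using assms by (simp add: power_le_one)
  then have "max 0 (e\<^sup>2 - z \<bullet> z) \<le> 1" using inner_ge_zero[of z] by (intro max.boundedI) linarith+
  then show ?thesis by (simp add: bump_def power_le_one)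
qed

lemma continuous_bump [continuous_intros]:
  "continuous_on A f \<Longrightarrow> continuous_on A (\<lambda>x. bump e (f x))"
  unfolding bump_def by (intro continuous_intros)

lemma measurable_bump [measurable]: "bump e \<in> borel_measurable borel"
  by (intro borel_measurable_continuous_onI continuous_intros)

text \<open>The profile (max 0 (c - s))^2 has the 2-Lipschitz derivative - 2 max 0 (c - s), so its
  first-order remainder is at most (s' - s)^2, also when s and s' lie on different sides of
  c.\<close>

lemma max_square_taylor:
  fixes c s s' :: real
  shows "\<bar>(max 0 (c - s'))\<^sup>2 - (max 0 (c - s))\<^sup>2 + 2 * max 0 (c - s) * (s' - s)\<bar> \<le> (s' - s)\<^sup>2"
proof -
  consider "s \<le> c" "s' \<le> c" | "s \<le> c" "s' > c" | "s > c" "s' \<le> c" | "s > c" "s' > c" by linarith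
  then show ?thesis
  proof cases
    case 1
    then have "(max 0 (c - s'))\<^sup>2 - (max 0 (c - s))\<^sup>2 + 2 * max 0 (c - s) * (s' - s) = (s' - s)\<^sup>2"
      by (simp add: power2_eq_square algebra_simps)
    then show ?thesis by simp
  next
    case 2
    then have "0 \<le> c - s" "c - s \<le> s' - s" by auto
    then have "(c - s) * (c - s) \<le> (c - s) * (s' - s)" by (intro mult_left_mono) auto
    moreover have "0 \<le> ((s' - s) - (c - s))\<^sup>2" by simp
    moreover have "0 \<le> (c - s) * (s' - s)" using 2 by simp
    ultimately show ?thesis using 2 by (simp add: power2_eq_square algebra_simps abs_if)
  next
    case 3
    then have "(c - s')\<^sup>2 \<le> (s - s')\<^sup>2" by (intro power_mono) auto
    then show ?thesis using 3 by (simp add: power2_commute)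
  next
    case 4 then show ?thesis by simp
  qed
qed

text \<open>The one-variable remainder at s = |z|^2 contributes (|z'|^2 - |z|^2)^2, hence the factor
  (|z'| + |z|)^2. Linearising |z|^2 itself leaves |z' - z|^2 times at most 2 e^2.\<close>

lemma bump_taylor:
  fixes z z' :: "'a::euclidean_space"
  shows "\<bar>bump e z' - bump e z - bump_deriv e z (z' - z)\<bar>
    \<le> ((norm z' + norm z)\<^sup>2 + 2 * e\<^sup>2) * (norm (z' - z))\<^sup>2"
proof -
  let ?p = "max 0 (e\<^sup>2 - z \<bullet> z)"
  have s: "z' \<bullet> z' - z \<bullet> z = 2 * (z \<bullet> (z' - z)) + (z' - z) \<bullet> (z' - z)"
    by (simp add: algebra_simps inner_commute)
  have "bump e z' - bump e z - bump_deriv e z (z' - z)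
     = ((max 0 (e\<^sup>2 - z' \<bullet> z'))\<^sup>2 - ?p\<^sup>2 + 2 * ?p * (z' \<bullet> z' - z \<bullet> z)) - 2 * ?p * (norm (z' - z))\<^sup>2"
    unfolding s bump_def bump_deriv_def power2_norm_eq_inner by (simp add: algebra_simps)
  also have "\<bar>\<dots>\<bar> \<le> (z' \<bullet> z' - z \<bullet> z)\<^sup>2 + 2 * e\<^sup>2 * (norm (z' - z))\<^sup>2"
  proof -
    have "2 * ?p * (norm (z' - z))\<^sup>2 \<le> 2 * e\<^sup>2 * (norm (z' - z))\<^sup>2"
      by (intro mult_right_mono) auto
    moreover have "0 \<le> 2 * ?p * (norm (z' - z))\<^sup>2" by simp
    ultimately show ?thesis
      using max_square_taylor[of "e\<^sup>2" "z' \<bullet> z'" "z \<bullet> z"] by linarith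
  qed
  also have "(z' \<bullet> z' - z \<bullet> z)\<^sup>2 \<le> (norm z' + norm z)\<^sup>2 * (norm (z' - z))\<^sup>2"
  proof -
    have "z' \<bullet> z' - z \<bullet> z = (norm z' + norm z) * (norm z' - norm z)"
      by (simp add: power2_norm_eq_inner[symmetric] power2_eq_square algebra_simps)
    moreover have "(norm z' - norm z)\<^sup>2 \<le> (norm (z' - z))\<^sup>2"
      using norm_triangle_ineq3[of z' z] by (intro abs_le_square_iff[THEN iffD1]) auto
    ultimately show ?thesis by (simp add: power_mult_distrib mult_left_mono)
  qed
  finally show ?thesis by (simp add: algebra_simps)
qed

lemma has_derivative_bump: "(bump e has_derivative bump_deriv e z) (at z)"
proof -
  let ?c = "e\<^sup>2"
  have "((\<lambda>h. ((max 0 (?c - (s + h)))\<^sup>2 - (max 0 (?c - s))\<^sup>2) / h - (- 2 * max 0 (?c - s))) \<longlongrightarrow> 0) (at 0)" for s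
  proof (rule Lim_null_comparison)
    show "((\<lambda>h::real. \<bar>h\<bar>) \<longlongrightarrow> 0) (at 0)" by (rule tendsto_rabs_zero) (rule tendsto_ident_at)
    show "\<forall>\<^sub>F h in at 0. norm (((max 0 (?c - (s + h)))\<^sup>2 - (max 0 (?c - s))\<^sup>2) / h - (- 2 * max 0 (?c - s))) \<le> \<bar>h\<bar>"
      unfolding eventually_at_filter
    proof (intro always_eventually allI impI)
      fix h :: real assume h: "h \<noteq> 0"
      have "((max 0 (?c - (s + h)))\<^sup>2 - (max 0 (?c - s))\<^sup>2) / h - (- 2 * max 0 (?c - s))
        = ((max 0 (?c - (s + h)))\<^sup>2 - (max 0 (?c - s))\<^sup>2 + 2 * max 0 (?c - s) * ((s + h) - s)) / h"
        using h by (simp add: field_simps)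
      also have "norm \<dots> \<le> ((s + h) - s)\<^sup>2 / \<bar>h\<bar>"
        using max_square_taylor[of ?c "s + h" s] by (simp add: divide_right_mono abs_divide)
      also have "\<dots> = \<bar>h\<bar>" using h by (simp add: power2_eq_square abs_if)
      finally show "norm (((max 0 (?c - (s + h)))\<^sup>2 - (max 0 (?c - s))\<^sup>2) / h - (- 2 * max 0 (?c - s))) \<le> \<bar>h\<bar>" .
    qed
  qed
  then have "((\<lambda>s. (max 0 (?c - s))\<^sup>2) has_real_derivative (- 2 * max 0 (?c - s))) (at s)" for s
    unfolding DERIV_def using Lim_null by blast
  then have "((\<lambda>s. (max 0 (?c - s))\<^sup>2) has_derivative (\<lambda>h. (- 2 * max 0 (?c - z \<bullet> z)) * h)) (at (z \<bullet> z))"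
    by (simp only: has_field_derivative_def)
  moreover have "((\<lambda>z. z \<bullet> z) has_derivative (\<lambda>w. z \<bullet> w + w \<bullet> z)) (at z)"
    by (intro derivative_intros)
  ultimately have "((\<lambda>z. (max 0 (?c - z \<bullet> z))\<^sup>2) has_derivative (\<lambda>w. (- 2 * max 0 (?c - z \<bullet> z)) * (z \<bullet> w + w \<bullet> z))) (at z)"
    by (rule has_derivative_compose[rotated])
  then show ?thesis
    unfolding bump_def by (rule has_derivative_eq_rhs) (simp add: bump_deriv_def fun_eq_iff inner_commute)
qed

text \<open>Supplies the divisor for averages weighted by \<open>bump e\<close>. If the integral
  vanished, the open ball of radius e would be a null set.\<close>

lemma integral_bump_pos:
  assumes "0 < e" shows "0 < (\<integral>z. bump e (z::'a::euclidean_space) \<partial>lborel)"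
proof -
  have bd: "\<bar>bump e (z::'a)\<bar> \<le> (e\<^sup>2)\<^sup>2" for z
    using power_mono[of "max 0 (e\<^sup>2 - z \<bullet> z)" "e\<^sup>2" 2] by (simp only: bump_def abs_power2) simp
  have int: "integrable lborel (bump e :: 'a \<Rightarrow> real)"
    by (rule integrable_bounded_support(1)[where R = e, OF _ bd]) (use assms in \<open>auto intro: bump_eq_0\<close>)
  have "(\<integral>z. bump e (z::'a) \<partial>lborel) \<noteq> 0"
  proof
    assume "(\<integral>z. bump e (z::'a) \<partial>lborel) = 0"
    then have "AE z::'a in lborel. bump e z = 0"
      using integral_nonneg_eq_0_iff_AE[OF int] bump_nonneg by auto
    then have "AE z::'a in lborel. z \<notin> ball 0 e"
    proof eventually_elim
      case (elim z)
      show ?case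
      proof
        assume "z \<in> ball 0 e"
        then have "(norm z)\<^sup>2 < e\<^sup>2" using assms by (intro power_strict_mono) auto
        then show False using elim by (simp add: bump_def power2_norm_eq_inner max_def split: if_splits)
      qed
    qed
    then have "emeasure lborel (ball (0::'a) e) = 0"
      by (subst (asm) AE_iff_measurable[OF _ refl]) (auto simp: ball_def)
    then show False using assms
      by (metis Sigma_Algebra.measure_def content_ball_pos enn2real_0 less_irrefl)
  qed
  moreover have "0 \<le> (\<integral>z. bump e (z::'a) \<partial>lborel)" by (simp add: bump_nonneg)
  ultimately show ?thesis by simp
qed

subsection \<open>Preservation of Lebesgue measure\<close>

context lipschitz_flow
begin

text \<open>The field may grow linearly, so displacements have no bound uniform in space. One
  bounded trajectory together with the distance estimates controls all others.\<close>

lemma flow_origin_bounded: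
  assumes "0 \<le> T"
  obtains \<beta> where "0 \<le> \<beta>" "\<And>s. 0 \<le> s \<Longrightarrow> s \<le> T \<Longrightarrow> norm (\<phi> s 0) \<le> \<beta>"
proof -
  have "compact ((\<lambda>s. \<phi> s 0) ` {0..T})"
    by (intro compact_continuous_image continuous_on_subset[OF flow_continuous_time]) auto
  then obtain \<beta> where \<beta>: "\<And>y. y \<in> (\<lambda>s. \<phi> s 0) ` {0..T} \<Longrightarrow> norm y \<le> \<beta>"
    using compact_imp_bounded bounded_iff by metis
  moreover have "0 \<le> \<beta>" using \<beta>[of "\<phi> 0 0"] assms by force
  ultimately show thesis using that by auto
qed

text \<open>Comparison with the trajectory of the origin by the lower distance bound. The radius is
  uniform for s <= T, so compactly supported functions composed with the flow keep their supports in
  one fixed ball.\<close>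

lemma flow_proper:
  assumes "0 \<le> s" "s \<le> T" "norm (\<phi> s 0) \<le> \<beta>" "norm (\<phi> s x) \<le> r"
  shows "norm x \<le> exp (L * T) * (r + \<beta>)"
proof -
  have "norm x = dist x 0" by simp
  also have "\<dots> \<le> exp (L * s) * dist (\<phi> s x) (\<phi> s 0)" by (rule flow_dist_ge) fact
  also have "\<dots> \<le> exp (L * T) * (r + \<beta>)"
  proof (rule mult_mono)
    show "exp (L * s) \<le> exp (L * T)" using assms L_nonneg by (simp add: mult_left_mono)
    show "dist (\<phi> s x) (\<phi> s 0) \<le> r + \<beta>"
      using assms norm_triangle_ineq4[of "\<phi> s x" "\<phi> s 0"] by (simp add: dist_norm)
  qed auto
  finally show ?thesis .
qed

lemma v_bound: "norm (v x) \<le> norm (v 0) + L * norm x"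
  using lipschitz_onD[OF lip, of x 0] norm_triangle_ineq2[of "v x" "v 0"] by (simp add: dist_norm)

lemma v_continuous: "continuous_on A v"
  using lipschitz_on_continuous_on[OF lip] continuous_on_subset by blast

text \<open>To first order in h the integrand is h times the derivative of the bump at y - x in
  direction - v x. This term integrates to 0, because x going to \<open>bump e (y - x)\<close> is an
  admissible test function for \<open>divergence_free\<close>. The remainder is O(h^2) on a fixed
  ball and 0 outside. Uniformity over |y| <= \<rho> is what permits integrating the estimate against
  a function supported there.\<close>

lemma bump_transport_second_order:
  assumes div: "divergence_free v" and e: "0 < e" "e \<le> 1" and \<rho>: "0 \<le> \<rho>"
  shows "\<exists>C\<ge>0. \<forall>h y. 0 \<le> h \<longrightarrow> h \<le> 1 \<longrightarrow> norm y \<le> \<rho> \<longrightarrow>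
    \<bar>\<integral>x. bump e (y - \<phi> h x) - bump e (y - x) \<partial>lborel\<bar> \<le> C * h\<^sup>2"
proof -
  obtain \<beta> where \<beta>: "0 \<le> \<beta>" "\<And>s. 0 \<le> s \<Longrightarrow> s \<le> 1 \<Longrightarrow> norm (\<phi> s 0) \<le> \<beta>"
    by (rule flow_origin_bounded[of 1]) auto
  \<comment> \<open>Outside radius \<open>R2\<close> both bump terms vanish, the summand 1 absorbing
    e <= 1. \<open>R3\<close> bounds the orbits starting inside it up to time 1, \<open>V\<close>
    their speed, and \<open>P\<close> both arguments of the bump.\<close>
  define R2 where "R2 = exp L * (\<rho> + 1 + \<beta>)"
  define R3 where "R3 = exp L * R2 + \<beta>"
  define V where "V = norm (v 0) + L * R3"
  define P where "P = \<rho> + R3"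
  define C0 where "C0 = (4 * P\<^sup>2 + 2) * V\<^sup>2 + 4 * P * (L * V)"
  have eL: "1 \<le> exp L" using L_nonneg by simp
  have R2: "\<rho> + 1 \<le> R2" "0 \<le> R2"
  proof -
    have "1 * (\<rho> + 1 + \<beta>) \<le> R2"
      unfolding R2_def using \<beta>(1) \<rho> by (intro mult_right_mono eL) auto
    then show "\<rho> + 1 \<le> R2" "0 \<le> R2" using \<beta>(1) \<rho> by auto
  qed
  have R3: "R2 \<le> R3" "0 \<le> R3"
    using mult_right_mono[OF eL R2(2)] \<beta>(1) R2 by (auto simp: R3_def)
  have V: "0 \<le> V" using R3 L_nonneg by (simp add: V_def)
  have P: "0 \<le> P" using \<rho> R3 by (simp add: P_def)
  have C0: "0 \<le> C0" using P V L_nonneg by (simp add: C0_def)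
  have far: "norm (y - x) > e \<and> norm (y - \<phi> h x) > e"
    if "norm y \<le> \<rho>" "norm x > R2" "0 \<le> h" "h \<le> 1" for x y h
  proof
    show "norm (y - x) > e" using that R2 e norm_triangle_ineq2[of x y] by (simp add: norm_minus_commute)
    have "\<not> norm (\<phi> h x) \<le> \<rho> + 1"
      using flow_proper[of h 1 \<beta> x "\<rho> + 1"] \<beta>(2)[of h] that by (auto simp: R2_def)
    then show "norm (y - \<phi> h x) > e"
      using that e norm_triangle_ineq2[of "\<phi> h x" y] by (simp add: norm_minus_commute)
  qed
  have R3b: "norm (\<phi> s x) \<le> R3" if "norm x \<le> R2" "0 \<le> s" "s \<le> 1" for x s
  proof -
    have "norm (\<phi> s x) \<le> dist (\<phi> s x) (\<phi> s 0) + \<beta>"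
      using \<beta>(2)[of s] that norm_triangle_ineq2[of "\<phi> s x" "\<phi> s 0"] by (simp add: dist_norm)
    also have "dist (\<phi> s x) (\<phi> s 0) \<le> exp (L * s) * dist x 0" by (rule flow_dist_le) fact
    also have "\<dots> \<le> exp L * R2"
      using that L_nonneg mult_left_mono[of s 1 L] R2 by (intro mult_mono) auto
    finally show ?thesis by (simp add: R3_def)
  qed
  have Vb: "norm (\<phi> s x - x) \<le> V * s" if "norm x \<le> R2" "0 \<le> s" "s \<le> 1" for x s
  proof -
    have "norm (v (\<phi> r x) - 0) \<le> V" if "0 \<le> r" "r \<le> s" for r
    proof -
      have "norm (v (\<phi> r x)) \<le> norm (v 0) + L * norm (\<phi> r x)" by (rule v_bound)
      also have "\<dots> \<le> V"
        unfolding V_def using R3b[of x r] that \<open>norm x \<le> R2\<close> \<open>s \<le> 1\<close> L_nonneg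
        by (intro add_left_mono mult_left_mono) auto
      finally show ?thesis by simp
    qed
    from flow_increment_bound[OF that(2) this] show ?thesis by simp
  qed
  have Db: "norm (\<phi> h x - x - h *\<^sub>R v x) \<le> L * V * h * h" if x: "norm x \<le> R2" "0 \<le> h" "h \<le> 1" for x h
  proof (rule flow_increment_bound[OF x(2)])
    fix s assume s: "0 \<le> s" "s \<le> h"
    have "norm (v (\<phi> s x) - v x) \<le> L * norm (\<phi> s x - x)"
      using lipschitz_onD[OF lip, of "\<phi> s x" x] by (simp add: dist_norm)
    also have "\<dots> \<le> L * (V * s)" using L_nonneg Vb[of x s] s x by (intro mult_left_mono) auto
    also have "\<dots> \<le> L * (V * h)" using L_nonneg V s by (intro mult_left_mono) auto
    finally show "norm (v (\<phi> s x) - v x) \<le> L * V * h" by (simp add: mult.assoc)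
  qed
  have deriv_zero: "(\<integral>x. bump_deriv e (y - x) (- v x) \<partial>lborel) = 0"
    and deriv_int: "integrable lborel (\<lambda>x. bump_deriv e (y - x) (- v x))" if y: "norm y \<le> \<rho>" for y
  proof -
    let ?\<psi>' = "\<lambda>x w. bump_deriv e (y - x) (- w)"
    have cont: "continuous_on UNIV (\<lambda>x. ?\<psi>' x (f x))" if "continuous_on UNIV f" for f
      unfolding bump_deriv_def using that by (intro continuous_intros)
    have supp: "bump e (y - x) = 0" if "x \<notin> cball 0 R2" for x
      using far[OF y, of x 0] that e by (auto intro!: bump_eq_0)
    have "((\<lambda>x. bump e (y - x)) has_derivative ?\<psi>' x) (at x)" for x
    proof -
      have "((\<lambda>x. y - x) has_derivative (\<lambda>w. - w)) (at x)" by (auto intro!: derivative_eq_intros)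
      from has_derivative_compose[OF this has_derivative_bump] show ?thesis .
    qed
    then have zero: "integral\<^sup>L lebesgue (\<lambda>x. ?\<psi>' x (v x)) = 0"
    proof (rule div[unfolded divergence_free_def, rule_format])
      show "continuous_on UNIV (\<lambda>x. ?\<psi>' x b)" for b by (rule cont) (rule continuous_on_const)
      show "\<exists>K. compact K \<and> (\<forall>x. x \<notin> K \<longrightarrow> bump e (y - x) = 0)"
        using supp by (intro exI[of _ "cball 0 R2"]) auto
    qed
    have meas: "(\<lambda>x. ?\<psi>' x (v x)) \<in> borel_measurable borel"
      by (intro borel_measurable_continuous_onI cont v_continuous)
    then have "(\<lambda>x. ?\<psi>' x (v x)) \<in> borel_measurable lborel" by simp
    from integral_completion[OF this] zero show "(\<integral>x. ?\<psi>' x (v x) \<partial>lborel) = 0"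
      by (simp only:)
    have "compact ((\<lambda>x. ?\<psi>' x (v x)) ` cball 0 R2)"
      by (rule compact_continuous_image[OF continuous_on_subset[OF cont[OF v_continuous]]]) simp_all
    from compact_imp_bounded[OF this]
    obtain B where B: "\<forall>x\<in>cball 0 R2. \<bar>?\<psi>' x (v x)\<bar> \<le> B"
      unfolding bounded_iff by (auto simp only: ball_simps real_norm_def)
    have out: "?\<psi>' x (v x) = 0" if "x \<notin> cball 0 R2" for x
      using far[OF y, of x 0] that e by (auto intro!: bump_deriv_eq_0)
    have "\<bar>?\<psi>' x (v x)\<bar> \<le> max 0 B" for x
      using bspec[OF B, of x] out[of x] by (cases "x \<in> cball 0 R2") (auto simp del: mem_cball)
    then show "integrable lborel (\<lambda>x. ?\<psi>' x (v x))"
      by (rule integrable_bounded_support(1)[OF meas _ out])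
  qed
  have "\<bar>\<integral>x. bump e (y - \<phi> h x) - bump e (y - x) \<partial>lborel\<bar> \<le> C0 * measure lborel (cball (0::'a) R2) * h\<^sup>2"
    if h: "0 \<le> h" "h \<le> 1" and y: "norm y \<le> \<rho>" for h y
  proof -
    let ?D = "\<lambda>x. bump e (y - \<phi> h x) - bump e (y - x)"
    let ?E = "\<lambda>x. ?D x - h * bump_deriv e (y - x) (- v x)"
    have [measurable]: "\<phi> h \<in> borel_measurable borel" by (rule flow_measurable) fact
    have Dout: "?D x = 0" if "x \<notin> cball 0 R2" for x
      using far[OF y, of x h] that e h by (auto simp: bump_eq_0)
    have Dint: "integrable lborel ?D"
    proof (rule integrable_bounded_support(1)[OF _ _ Dout])
      show "\<bar>?D x\<bar> \<le> 1" for x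
        using bump_nonneg[of e "y - \<phi> h x"] bump_nonneg[of e "y - x"]
          bump_le_1[of e "y - \<phi> h x"] bump_le_1[of e "y - x"] e by linarith
    qed auto
    have Eint: "integrable lborel ?E" using Dint deriv_int[OF y] by auto
    have Ebd: "\<bar>?E x\<bar> \<le> C0 * h\<^sup>2" if x: "norm x \<le> R2" for x
    proof -
      let ?z = "y - x" let ?\<Delta> = "\<phi> h x - x"
      let ?p = "max 0 (e\<^sup>2 - ?z \<bullet> ?z)"
      have zP: "norm ?z \<le> P" using norm_triangle_ineq4[of y x] x y R3 by (simp add: P_def)
      have zP': "norm (y - \<phi> h x) \<le> P"
        using norm_triangle_ineq4[of y "\<phi> h x"] R3b[OF x h] y by (simp add: P_def)
      have e2: "e\<^sup>2 \<le> 1" using e by (simp add: power_le_one)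
      have p: "0 \<le> ?p" "?p \<le> 1" using e2 inner_ge_zero[of ?z] by (simp, intro max.boundedI, linarith+)
      have z': "y - \<phi> h x - ?z = - ?\<Delta>" by simp
      have \<Delta>: "norm ?\<Delta> \<le> V * h" by (rule Vb[OF x h])
      \<comment> \<open>Two errors are separated: \<open>t1\<close> is the Taylor error at the true
        displacement, \<open>t2\<close> the error from replacing that displacement by h v x.\<close>
      have t1: "\<bar>?D x - bump_deriv e ?z (- ?\<Delta>)\<bar> \<le> (4 * P\<^sup>2 + 2) * V\<^sup>2 * h\<^sup>2"
      proof -
        have "\<bar>?D x - bump_deriv e ?z (- ?\<Delta>)\<bar> \<le> ((norm (y - \<phi> h x) + norm ?z)\<^sup>2 + 2 * e\<^sup>2) * (norm ?\<Delta>)\<^sup>2"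
          using bump_taylor[of e "y - \<phi> h x" ?z] unfolding z' by (simp add: norm_minus_commute)
        also have "\<dots> \<le> ((P + P)\<^sup>2 + 2 * 1) * (V * h)\<^sup>2"
          using zP zP' \<Delta> e2 by (intro mult_mono add_mono power_mono mult_left_mono) auto
        also have "\<dots> = (4 * P\<^sup>2 + 2) * V\<^sup>2 * h\<^sup>2" by (simp add: power2_eq_square algebra_simps)
        finally show ?thesis .
      qed
      have "bump_deriv e ?z (- ?\<Delta>) - h * bump_deriv e ?z (- v x) = 4 * ?p * (?z \<bullet> (?\<Delta> - h *\<^sub>R v x))"
        by (simp add: bump_deriv_def inner_diff_right algebra_simps)
      also have "\<bar>\<dots>\<bar> = 4 * ?p * \<bar>?z \<bullet> (?\<Delta> - h *\<^sub>R v x)\<bar>" using p by (simp add: abs_mult)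
      also have "\<dots> \<le> 4 * 1 * (P * (L * V * h * h))"
      proof (rule mult_mono)
        have "\<bar>?z \<bullet> (?\<Delta> - h *\<^sub>R v x)\<bar> \<le> norm ?z * norm (?\<Delta> - h *\<^sub>R v x)"
          by (rule Cauchy_Schwarz_ineq2)
        also have "\<dots> \<le> P * (L * V * h * h)" using zP P Db[OF x h] by (intro mult_mono) auto
        finally show "\<bar>?z \<bullet> (?\<Delta> - h *\<^sub>R v x)\<bar> \<le> P * (L * V * h * h)" .
      qed (use p in auto)
      finally have t2: "\<bar>bump_deriv e ?z (- ?\<Delta>) - h * bump_deriv e ?z (- v x)\<bar> \<le> 4 * P * (L * V) * h\<^sup>2"
        by (simp add: power2_eq_square algebra_simps)
      have "C0 * h\<^sup>2 = (4 * P\<^sup>2 + 2) * V\<^sup>2 * h\<^sup>2 + 4 * P * (L * V) * h\<^sup>2"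
        by (simp add: C0_def algebra_simps)
      then show ?thesis using t1 t2 by linarith
    qed
    have Eout: "?E x = 0" if "x \<notin> cball 0 R2" for x
      using far[OF y, of x 0] Dout[OF that] that e by (auto simp: bump_deriv_eq_0)
    have "(\<integral>x. ?D x \<partial>lborel) = (\<integral>x. ?E x \<partial>lborel)"
      using Dint deriv_int[OF y] deriv_zero[OF y] by simp
    also have "\<bar>\<dots>\<bar> \<le> C0 * h\<^sup>2 * measure lborel (cball (0::'a) R2)"
    proof (rule integrable_bounded_support(2)[OF _ _ Eout])
      show "?E \<in> borel_measurable borel" using Eint by auto
      show "\<bar>?E x\<bar> \<le> C0 * h\<^sup>2" for x
        using Ebd[of x] Eout[of x] C0 by (cases "x \<in> cball 0 R2") (auto simp: mem_cball_0)
    qed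
    finally show ?thesis by (simp add: mult_ac)
  qed
  then show ?thesis using C0 by (intro exI[of _ "C0 * measure lborel (cball (0::'a) R2)"]) auto
qed

text \<open>\<open>G\<close> is only Lipschitz, so the divergence condition cannot be tested with it. By translation
  invariance \<open>G\<close> may be replaced by \<open>G (_ + z)\<close>, up to an error \<open>O(h e)\<close> because \<open>\<phi> h - id\<close> has Lipschitz
  constant \<open>O(h)\<close>. Averaging over \<open>z\<close> with weight \<open>bump e\<close> then moves the increment
  from \<open>G\<close> to the bump function, where it is \<open>O(h\<^sup>2)\<close>.\<close>
lemma integral_transport_step:
  fixes G :: "'a \<Rightarrow> real"
  assumes bump_step: "\<And>y. norm y \<le> \<rho> \<Longrightarrow> \<bar>\<integral>x. bump e (y - \<phi> h x) - bump e (y - x) \<partial>lborel\<bar> \<le> C * h\<^sup>2"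
    and C: "0 \<le> C" and e: "0 < e" "e \<le> 1" and h: "0 \<le> h" "h \<le> 1"
    and \<beta>: "0 \<le> \<beta>" "\<And>s. 0 \<le> s \<Longrightarrow> s \<le> 1 \<Longrightarrow> norm (\<phi> s 0) \<le> \<beta>"
    and G: "\<Lambda>-lipschitz_on UNIV G" "\<And>x. \<bar>G x\<bar> \<le> M" "\<And>x. norm x > \<rho> \<Longrightarrow> G x = 0"
    and R_def: "R = exp L * (\<rho> + 1 + \<beta>) + 1" and \<rho>: "0 \<le> \<rho>"
  shows "\<bar>(\<integral>x. G (\<phi> h x) \<partial>lborel) - (\<integral>x. G x \<partial>lborel)\<bar>
    \<le> \<Lambda> * (L * exp L * h * e) * measure lborel (cball (0::'a) R)
      + M * C * measure lborel (cball (0::'a) \<rho>) / (\<integral>z. bump e (z::'a) \<partial>lborel) * h\<^sup>2"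
proof -
  have [measurable]: "\<phi> h \<in> borel_measurable borel" by (rule flow_measurable) fact
  have Gcont: "continuous_on A G" for A
    using lipschitz_on_continuous_on[OF G(1)] continuous_on_subset by blast
  then have [measurable]: "G \<in> borel_measurable borel"
    by (intro borel_measurable_continuous_onI)
  have \<Lambda>: "0 \<le> \<Lambda>" using G(1) lipschitz_on_nonneg by blast
  have M: "0 \<le> M" using G(2)[of 0] by linarith
  have eL: "1 \<le> exp L" using L_nonneg by simp
  have R: "exp L * (\<rho> + 1 + \<beta>) + 1 \<le> R" "\<rho> + 1 \<le> R" "\<rho> \<le> R"
  proof -
    have *: "\<rho> + 1 + \<beta> \<le> exp L * (\<rho> + 1 + \<beta>)"
      using mult_right_mono[OF eL, of "\<rho> + 1 + \<beta>"] \<beta>(1) \<rho> by (simp only: mult_1)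
    show "exp L * (\<rho> + 1 + \<beta>) + 1 \<le> R" by (simp add: R_def)
    show "\<rho> + 1 \<le> R" using * \<beta>(1) unfolding R_def by linarith
    then show "\<rho> \<le> R" by simp
  qed
  have out1: "G (\<phi> h x + z) = 0" if "norm z \<le> 1" "norm x > R" for x z
  proof (rule G(3), rule ccontr)
    assume "\<not> \<rho> < norm (\<phi> h x + z)"
    then have "norm (\<phi> h x) \<le> \<rho> + 1" using that norm_diff_ineq[of "\<phi> h x" z] by linarith
    from flow_proper[OF h \<beta>(2)[OF h] this] show False using that R by simp
  qed
  have out2: "G (x + z) = 0" if "norm z \<le> 1" "norm x > R" for x z
    using G(3)[of "x + z"] that R norm_diff_ineq[of x z] by linarith
  have out3: "G (\<phi> h (x + z)) = 0" if "norm z \<le> 1" "norm x > R" for x z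
  proof (rule G(3), rule ccontr)
    assume "\<not> \<rho> < norm (\<phi> h (x + z))"
    then have "norm (\<phi> h (x + z)) \<le> \<rho> + 1" by linarith
    from flow_proper[OF h \<beta>(2)[OF h] this] show False
      using that R norm_diff_ineq[of x z] by simp
  qed
  let ?vol = "\<lambda>r. measure lborel (cball (0::'a) r)"
  let ?b = "bump e :: 'a \<Rightarrow> real"
  define I where "I = (\<integral>z. ?b z \<partial>lborel)"
  define J where "J = (\<lambda>y. \<integral>x. bump e (y - \<phi> h x) - bump e (y - x) \<partial>lborel)"
  define D where "D = (\<integral>x. G (\<phi> h x) - G x \<partial>lborel)"
  define A where "A = (\<lambda>z. \<integral>x. G (\<phi> h x + z) - G (x + z) \<partial>lborel)"
  define K where "K = \<Lambda> * (L * exp L * h * e)"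
  have I: "0 < I" unfolding I_def by (rule integral_bump_pos) fact
  have K: "0 \<le> K" using \<Lambda> L_nonneg h e by (simp add: K_def)
  have mul_bound: "\<bar>a * b\<bar> \<le> A * B" if "\<bar>a\<bar> \<le> A" "\<bar>b\<bar> \<le> B" for a b A B :: real
    unfolding abs_mult using that by (intro mult_mono) auto
  have b_abs: "\<bar>bump e a\<bar> \<le> 1" for a :: 'a
    using bump_nonneg[of e a] bump_le_1[of e a] e by simp
  have b_int: "integrable lborel ?b"
    by (rule integrable_bounded_support(1)[OF measurable_bump b_abs, where R = 1])
       (use e in \<open>auto intro!: bump_eq_0\<close>)
  have two_M: "\<bar>G a - G b\<bar> \<le> 2 * M" for a b
    using G(2)[of a] G(2)[of b] by linarith
  have int_shift: "integrable lborel (\<lambda>x. G (\<phi> h x + z) - G (x + z))" if "norm z \<le> 1" for z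
    by (rule integrable_bounded_support(1)[where K = "2 * M" and R = R])
       (use two_M out1[OF that] out2[OF that] in auto)
  have DA: "\<bar>D - A z\<bar> \<le> K * ?vol R" if z: "norm z \<le> e" for z
  proof -
    have z1: "norm z \<le> 1" using z e by simp
    have int3: "integrable lborel (\<lambda>x. G (\<phi> h (x + z)) - G (x + z))"
      by (rule integrable_bounded_support(1)[where K = "2 * M" and R = R])
         (use two_M out3[OF z1] out2[OF z1] in auto)
    have "D = (\<integral>x. G (\<phi> h (x + z)) - G (x + z) \<partial>lborel)"
      unfolding D_def using integral_lborel_translate[of "\<lambda>x. G (\<phi> h x) - G x" z]
      by (simp add: add.commute)
    then have "D - A z = (\<integral>x. G (\<phi> h (x + z)) - G (\<phi> h x + z) \<partial>lborel)"
      unfolding A_def using int3 int_shift[OF z1]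
      by (simp flip: Bochner_Integration.integral_diff)
    also have "\<bar>\<dots>\<bar> \<le> K * ?vol R"
    proof (rule integrable_bounded_support(2))
      show "\<bar>G (\<phi> h (x + z)) - G (\<phi> h x + z)\<bar> \<le> K" for x
      proof -
        have "\<bar>G (\<phi> h (x + z)) - G (\<phi> h x + z)\<bar> \<le> \<Lambda> * norm (\<phi> h (x + z) - (\<phi> h x + z))"
          using lipschitz_onD[OF G(1), of "\<phi> h (x + z)" "\<phi> h x + z"] by (simp add: dist_norm)
        also have "\<phi> h (x + z) - (\<phi> h x + z) = (\<phi> h (x + z) - (x + z)) - (\<phi> h x - x)" by simp
        also have "\<Lambda> * norm \<dots> \<le> \<Lambda> * (L * exp L * h * norm ((x + z) - x))"
          by (intro mult_left_mono flow_increment_diff h \<Lambda>)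
        also have "\<dots> \<le> \<Lambda> * (L * exp L * h * e)"
          using z h L_nonneg \<Lambda> by (intro mult_left_mono) auto
        finally show ?thesis by (simp add: K_def)
      qed
    qed (use out1[OF z1] out3[OF z1] in auto)
    finally show ?thesis .
  qed
  \<comment> \<open>Two Fubini exchanges are needed, hence two product integrands: \<open>?W\<close>
    in translation and point, \<open>?U\<close> in point and bump centre, after the substitution y =
    w + z.\<close>
  let ?W = "\<lambda>(z, x). ?b z * (G (\<phi> h x + z) - G (x + z))"
  let ?U = "\<lambda>(x, y). G y * (bump e (y - \<phi> h x) - bump e (y - x))"
  have fin: "emeasure (lborel \<Otimes>\<^sub>M lborel) (cball (0::'a) r \<times> cball (0::'a) s) < \<infinity>" for r s
    by (subst lborel_prod, rule emeasure_bounded_finite) (auto intro: bounded_Times)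
  have W_int: "integrable (lborel \<Otimes>\<^sub>M lborel) ?W"
  proof (rule integrableI_bounded_set[where A = "cball 0 1 \<times> cball 0 R" and B = "1 * (2 * M)"])
    show "AE zx in lborel \<Otimes>\<^sub>M lborel. zx \<in> cball 0 1 \<times> cball 0 R \<longrightarrow> norm (?W zx) \<le> 1 * (2 * M)"
      unfolding split_beta real_norm_def by (intro AE_I2 impI mul_bound b_abs two_M)
    show "AE zx in lborel \<Otimes>\<^sub>M lborel. zx \<notin> cball 0 1 \<times> cball 0 R \<longrightarrow> ?W zx = 0"
    proof (intro AE_I2 impI)
      fix zx assume "zx \<notin> cball (0::'a) 1 \<times> cball (0::'a) R"
      then show "?W zx = 0"
        using out1[of "fst zx" "snd zx"] out2[of "fst zx" "snd zx"] e bump_eq_0[of e "fst zx"]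
        by (cases "norm (fst zx) \<le> 1") (auto simp: split_beta mem_Times_iff)
    qed
  qed (use fin in auto)
  have U_int: "integrable (lborel \<Otimes>\<^sub>M lborel) ?U"
  proof (rule integrableI_bounded_set[where A = "cball 0 R \<times> cball 0 \<rho>" and B = "M * 1"])
    have "\<bar>bump e a - bump e b\<bar> \<le> 1" for a b :: 'a
      using bump_nonneg[of e a] bump_nonneg[of e b] bump_le_1[of e a] bump_le_1[of e b] e by linarith
    then show "AE zx in lborel \<Otimes>\<^sub>M lborel. zx \<in> cball 0 R \<times> cball 0 \<rho> \<longrightarrow> norm (?U zx) \<le> M * 1"
      unfolding split_beta real_norm_def by (intro AE_I2 impI mul_bound G(2))
    show "AE zx in lborel \<Otimes>\<^sub>M lborel. zx \<notin> cball 0 R \<times> cball 0 \<rho> \<longrightarrow> ?U zx = 0"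
    proof (intro AE_I2 impI)
      fix zx assume *: "zx \<notin> cball (0::'a) R \<times> cball (0::'a) \<rho>"
      show "?U zx = 0"
      proof (cases "norm (snd zx) \<le> \<rho>")
        case False then show ?thesis using G(3) by (simp add: split_beta)
      next
        case True
        then have x: "norm (fst zx) > R" using * by (auto simp: mem_Times_iff)
        have "norm (snd zx - fst zx) > e"
          using x True R e norm_triangle_ineq2[of "fst zx" "snd zx"] by (simp add: norm_minus_commute)
        moreover have "norm (snd zx - \<phi> h (fst zx)) > e"
        proof (rule ccontr)
          assume "\<not> ?thesis"
          then have "norm (\<phi> h (fst zx)) \<le> \<rho> + 1"
            using True e norm_triangle_ineq2[of "\<phi> h (fst zx)" "snd zx"] by (simp add: norm_minus_commute)
          from flow_proper[OF h \<beta>(2)[OF h] this] show False using x R by simp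
        qed
        ultimately show ?thesis using e by (simp add: split_beta bump_eq_0)
      qed
    qed
  qed (use fin in auto)
  have bG_int: "integrable lborel (\<lambda>z. ?b z * G (w + z))" for w
    by (rule integrable_bounded_support(1)[OF _ mul_bound[OF b_abs G(2)], where R = 1])
       (use e in \<open>auto simp: bump_eq_0\<close>)
  have shift: "(\<integral>z. ?b z * G (w + z) \<partial>lborel) = (\<integral>y. bump e (y - w) * G y \<partial>lborel)"
    and bG_int': "integrable lborel (\<lambda>y. bump e (y - w) * G y)" for w
  proof -
    show "(\<integral>z. ?b z * G (w + z) \<partial>lborel) = (\<integral>y. bump e (y - w) * G y \<partial>lborel)"
      using integral_lborel_translate[of "\<lambda>y. bump e (y - w) * G y" w] by simp
    show "integrable lborel (\<lambda>y. bump e (y - w) * G y)"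
      by (rule integrable_bounded_support(1)[OF _ mul_bound[OF b_abs G(2)], where R = \<rho>])
         (auto simp: G(3))
  qed
  have "(\<integral>z. ?b z * A z \<partial>lborel) = (\<integral>z. (\<integral>x. ?b z * (G (\<phi> h x + z) - G (x + z)) \<partial>lborel) \<partial>lborel)"
    unfolding A_def by simp
  also have "\<dots> = (\<integral>x. (\<integral>z. ?b z * (G (\<phi> h x + z) - G (x + z)) \<partial>lborel) \<partial>lborel)"
    using lborel_pair.Fubini_integral[OF W_int] by simp
  also have "\<dots> = (\<integral>x. (\<integral>y. G y * (bump e (y - \<phi> h x) - bump e (y - x)) \<partial>lborel) \<partial>lborel)"
  proof (rule Bochner_Integration.integral_cong[OF refl])
    fix x
    have "(\<integral>z. ?b z * (G (\<phi> h x + z) - G (x + z)) \<partial>lborel)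
      = (\<integral>z. ?b z * G (\<phi> h x + z) \<partial>lborel) - (\<integral>z. ?b z * G (x + z) \<partial>lborel)"
      using bG_int[of "\<phi> h x"] bG_int[of x] by (simp add: right_diff_distrib)
    also have "\<dots> = (\<integral>y. G y * (bump e (y - \<phi> h x) - bump e (y - x)) \<partial>lborel)"
      unfolding shift using bG_int'[of "\<phi> h x"] bG_int'[of x] by (simp add: algebra_simps)
    finally show "(\<integral>z. ?b z * (G (\<phi> h x + z) - G (x + z)) \<partial>lborel)
      = (\<integral>y. G y * (bump e (y - \<phi> h x) - bump e (y - x)) \<partial>lborel)" .
  qed
  also have "\<dots> = (\<integral>y. G y * J y \<partial>lborel)"
    using lborel_pair.Fubini_integral[OF U_int] by (simp add: J_def)
  finally have bA: "(\<integral>z. ?b z * A z \<partial>lborel) = (\<integral>y. G y * J y \<partial>lborel)" .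
  have bA_int: "integrable lborel (\<lambda>z. ?b z * A z)"
    using lborel_pair.integrable_fst[OF W_int] by (simp add: A_def)
  have GJ: "\<bar>\<integral>y. G y * J y \<partial>lborel\<bar> \<le> M * (C * h\<^sup>2) * ?vol \<rho>"
  proof (rule integrable_bounded_support(2))
    show "(\<lambda>y. G y * J y) \<in> borel_measurable borel"
      unfolding J_def by measurable
    show "\<bar>G y * J y\<bar> \<le> M * (C * h\<^sup>2)" for y
      using bump_step[of y] G(2)[of y] G(3)[of y] M C
      by (cases "norm y \<le> \<rho>") (auto simp: abs_mult J_def intro!: mult_mono)
  qed (use G(3) in auto)
  have "\<bar>I * D - (\<integral>z. ?b z * A z \<partial>lborel)\<bar> = \<bar>\<integral>z. ?b z * (D - A z) \<partial>lborel\<bar>"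
    using b_int bA_int by (simp add: I_def right_diff_distrib)
  also have "\<dots> \<le> (\<integral>z. ?b z * (K * ?vol R) \<partial>lborel)"
  proof (rule Bochner_Integration.integral_norm_bound_integral[of _ "\<lambda>z. ?b z * (D - A z)", unfolded real_norm_def])
    show "integrable lborel (\<lambda>z. ?b z * (D - A z))"
      using b_int bA_int by (simp add: right_diff_distrib)
    show "integrable lborel (\<lambda>z. ?b z * (K * ?vol R))" using b_int by simp
    show "\<bar>?b z * (D - A z)\<bar> \<le> ?b z * (K * ?vol R)" for z
    proof (cases "norm z \<le> e")
      case True
      show ?thesis using mult_left_mono[OF DA[OF True] bump_nonneg[of e z]] by (simp add: abs_mult bump_nonneg)
    next
      case False then show ?thesis using e by (simp add: bump_eq_0)
    qed
  qed
  also have "\<dots> = I * (K * ?vol R)" by (simp add: I_def)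
  \<comment> \<open>\<open>D\<close> does not depend on z, so its weighted integral is I D. Dividing
    by I, which tends to 0 with e, is why the coefficient of h^2 depends on e.\<close>
  finally have "I * \<bar>D\<bar> \<le> I * (K * ?vol R) + M * (C * h\<^sup>2) * ?vol \<rho>"
    using GJ I unfolding bA by (simp add: abs_mult[of I D, symmetric] abs_if split: if_splits)
  then have "\<bar>D\<bar> \<le> K * ?vol R + M * C * ?vol \<rho> / I * h\<^sup>2"
    using I by (simp add: field_simps)
  moreover have "D = (\<integral>x. G (\<phi> h x) \<partial>lborel) - (\<integral>x. G x \<partial>lborel)"
  proof -
    have "integrable lborel (\<lambda>x. G (\<phi> h x))"
      by (rule integrable_bounded_support(1)[where K = M and R = R])
         (use G(2) out3[of 0] in auto)
    moreover have "integrable lborel G"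
      by (rule integrable_bounded_support(1)[where K = M and R = \<rho>]) (use G in auto)
    ultimately show ?thesis by (simp add: D_def)
  qed
  ultimately show ?thesis by (simp add: K_def I_def)
qed

text \<open>Gronwall gives all functions g o \<phi> s with 0 <= s <= T one Lipschitz constant and
  one support radius. The error of a single step is therefore independent of s, and the errors can
  be added up.\<close>

lemma integral_transport:
  fixes g :: "'a \<Rightarrow> real"
  assumes div: "divergence_free v" and T: "0 \<le> T"
    and g: "\<Lambda>-lipschitz_on UNIV g" and supp: "\<And>x. norm x > r \<Longrightarrow> g x = 0"
  shows "(\<integral>x. g (\<phi> T x) \<partial>lborel) = (\<integral>x. g x \<partial>lborel)"
proof -
  have gcont: "continuous_on (cball 0 r) g"
    using lipschitz_on_continuous_on[OF g] continuous_on_subset by blast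
  have "compact (g ` cball 0 r)" by (rule compact_continuous_image[OF gcont]) simp
  from compact_imp_bounded[OF this] obtain M0 where M0: "\<forall>x\<in>cball 0 r. \<bar>g x\<bar> \<le> M0"
    unfolding bounded_iff by (auto simp only: ball_simps real_norm_def)
  define M where "M = max 0 M0"
  have M: "\<bar>g x\<bar> \<le> M" for x
    using M0 supp[of x] by (cases "norm x \<le> r") (force simp: M_def)+
  obtain \<beta> where \<beta>: "0 \<le> \<beta>" "\<And>s. 0 \<le> s \<Longrightarrow> s \<le> max 1 T \<Longrightarrow> norm (\<phi> s 0) \<le> \<beta>"
    by (rule flow_origin_bounded[of "max 1 T"]) auto
  define \<rho> where "\<rho> = max 0 (exp (L * T) * (r + \<beta>))"
  define \<Lambda>' where "\<Lambda>' = \<Lambda> * exp (L * T)"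
  have \<rho>: "0 \<le> \<rho>" by (simp add: \<rho>_def)
  have \<Lambda>: "0 \<le> \<Lambda>" using g lipschitz_on_nonneg by blast
  have Gs: "\<Lambda>'-lipschitz_on UNIV (\<lambda>x. g (\<phi> s x))" "norm x > \<rho> \<Longrightarrow> g (\<phi> s x) = 0"
    if s: "0 \<le> s" "s \<le> T" for s x
  proof -
    show "\<Lambda>'-lipschitz_on UNIV (\<lambda>x. g (\<phi> s x))"
    proof (rule lipschitz_onI)
      fix x y
      have "dist (g (\<phi> s x)) (g (\<phi> s y)) \<le> \<Lambda> * dist (\<phi> s x) (\<phi> s y)"
        using lipschitz_onD[OF g] by auto
      also have "\<dots> \<le> \<Lambda> * (exp (L * s) * dist x y)"
        using \<Lambda> s by (intro mult_left_mono flow_dist_le) auto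
      also have "\<dots> \<le> \<Lambda> * (exp (L * T) * dist x y)"
        using \<Lambda> s L_nonneg by (intro mult_left_mono mult_right_mono) (auto simp: mult_left_mono)
      finally show "dist (g (\<phi> s x)) (g (\<phi> s y)) \<le> \<Lambda>' * dist x y"
        by (simp add: \<Lambda>'_def mult.assoc)
    qed (simp add: \<Lambda>'_def \<Lambda>)
    show "g (\<phi> s x) = 0" if x: "norm x > \<rho>"
    proof (rule supp, rule ccontr)
      assume "\<not> r < norm (\<phi> s x)"
      then have "norm x \<le> exp (L * T) * (r + \<beta>)"
        using flow_proper[OF s \<beta>(2)] s by auto
      then show False using x by (simp add: \<rho>_def)
    qed
  qed
  define F where "F = (\<lambda>s. \<integral>x. g (\<phi> s x) \<partial>lborel)"
  define R where "R = exp L * (\<rho> + 1 + \<beta>) + 1"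
  \<comment> \<open>This constant depends neither on e nor on the number of steps, in contrast to
    \<open>C3\<close> below; hence the step number goes to infinity before e goes to 0.\<close>
  define C1 where "C1 = \<Lambda>' * (L * exp L) * measure lborel (cball (0::'a) R)"
  have small: "\<bar>F T - F 0\<bar> \<le> C1 * T * e" if e: "0 < e" "e \<le> 1" for e
  proof -
    obtain C where C: "0 \<le> C" "\<And>h y. 0 \<le> h \<Longrightarrow> h \<le> 1 \<Longrightarrow> norm y \<le> \<rho> \<Longrightarrow>
        \<bar>\<integral>x. bump e (y - \<phi> h x) - bump e (y - x) \<partial>lborel\<bar> \<le> C * h\<^sup>2"
      using bump_transport_second_order[OF div e \<rho>] by blast
    define C3 where "C3 = M * C * measure lborel (cball (0::'a) \<rho>) / (\<integral>z. bump e (z::'a) \<partial>lborel)"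
    have step: "\<bar>F (s + h) - F s\<bar> \<le> C1 * e * h + C3 * h\<^sup>2"
      if h: "0 \<le> h" "h \<le> 1" and s: "0 \<le> s" "s \<le> T" for h s
    proof -
      \<comment> \<open>The short step acts first, so that g o \<phi> s is the fixed Lipschitz
        function and \<phi> h the map close to the identity.\<close>
      have "F (s + h) = (\<integral>x. g (\<phi> s (\<phi> h x)) \<partial>lborel)"
        unfolding F_def using flow_add[of h s] h s by (simp add: add.commute)
      moreover have "\<bar>(\<integral>x. g (\<phi> s (\<phi> h x)) \<partial>lborel) - (\<integral>x. g (\<phi> s x) \<partial>lborel)\<bar>
          \<le> \<Lambda>' * (L * exp L * h * e) * measure lborel (cball (0::'a) R) + C3 * h\<^sup>2"
        unfolding C3_def
        by (rule integral_transport_step[OF C(2)[OF h] C(1) e h \<beta>(1) _ Gs(1)[OF s] M Gs(2)[OF s] R_def \<rho>])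
           (use \<beta>(2) in auto)
      ultimately show ?thesis by (simp add: F_def C1_def mult_ac)
    qed
    \<comment> \<open>The condition n >= T keeps the step h = T / n at most 1. Adding n terms of
      size C3 h^2 leaves C3 T^2 / n.\<close>
    have discrete: "\<bar>F T - F 0\<bar> \<le> C1 * T * e + C3 * T\<^sup>2 * inverse (real n)" if n: "n \<ge> 1" "real n \<ge> T" for n
    proof -
      let ?h = "T / real n"
      have h: "0 \<le> ?h" "?h \<le> 1" using n T by (auto simp: field_simps)
      have "\<bar>F (real k * ?h) - F 0\<bar> \<le> real k * (C1 * e * ?h + C3 * ?h\<^sup>2)" if "k \<le> n" for k
        using that
      proof (induction k)
        case (Suc k)
        have "real k * ?h \<le> T"
        proof -
          have "real k * T \<le> real n * T" using Suc.prems T by (intro mult_right_mono) auto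
          then show ?thesis using n by (simp add: field_simps)
        qed
        moreover have "0 \<le> real k * ?h" using h by (intro mult_nonneg_nonneg) auto
        ultimately have 1: "\<bar>F (real k * ?h + ?h) - F (real k * ?h)\<bar> \<le> C1 * e * ?h + C3 * ?h\<^sup>2"
          using step[OF h] by blast
        have 2: "real (Suc k) * c = real k * c + c" for c
          by (simp only: of_nat_Suc distrib_right[of 1 "real k"] mult_1 add.commute)
        have "\<bar>F (real k * ?h) - F 0\<bar> \<le> real k * (C1 * e * ?h + C3 * ?h\<^sup>2)"
          using Suc by simp
        with 1 show ?case unfolding 2 by linarith
      qed simp
      from this[of n] have "\<bar>F T - F 0\<bar> \<le> real n * (C1 * e * ?h + C3 * ?h\<^sup>2)" using n by simp
      also have "\<dots> = C1 * T * e + C3 * T\<^sup>2 * inverse (real n)"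
        using n by (simp add: field_simps power2_eq_square)
      finally show ?thesis .
    qed
    have "(\<lambda>n. C1 * T * e + C3 * T\<^sup>2 * inverse (real n)) \<longlonglongrightarrow> C1 * T * e + C3 * T\<^sup>2 * 0"
      by (intro tendsto_intros lim_inverse_n)
    moreover have "\<forall>\<^sub>F n in sequentially. \<bar>F T - F 0\<bar> \<le> C1 * T * e + C3 * T\<^sup>2 * inverse (real n)"
    proof (rule eventually_sequentiallyI)
      fix n assume "n \<ge> max 1 (nat \<lceil>T\<rceil>)"
      then show "\<bar>F T - F 0\<bar> \<le> C1 * T * e + C3 * T\<^sup>2 * inverse (real n)"
        by (intro discrete) linarith+
    qed
    ultimately show ?thesis
      using tendsto_lowerbound[OF _ _ sequentially_bot] by fastforce
  qed
  have "\<bar>F T - F 0\<bar> \<le> 0"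
  proof (rule tendsto_lowerbound)
    show "((\<lambda>e. C1 * T * e) \<longlongrightarrow> 0) (at_right 0)"
      by (auto intro!: tendsto_eq_intros)
    show "\<forall>\<^sub>F e in at_right 0. \<bar>F T - F 0\<bar> \<le> C1 * T * e"
      by (rule eventually_at_rightI[of 0 1]) (use small in auto)
  qed simp
  then show ?thesis by (simp add: F_def)
qed

text \<open>Boxes determine Lebesgue measure. An open box is approximated from below by the
  Lipschitz functions min 1 (n dist (x, complement)), whose integrals are conserved. Dominated
  convergence on the box and on its preimage, bounded by \<open>flow_proper\<close>, turns this into
  equality of measures.\<close>

lemma flow_measure_preserving:
  assumes div: "divergence_free v" and T: "0 \<le> T"
  shows "distr lborel borel (\<phi> T) = lborel"
proof (rule lborel_eqI[symmetric])
  have [measurable]: "\<phi> T \<in> borel_measurable borel" by (rule flow_measurable) fact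
  fix l u :: 'a assume lu: "\<And>b. b \<in> Basis \<Longrightarrow> l \<bullet> b \<le> u \<bullet> b"
  define B where "B = box l u"
  have Bm [measurable]: "B \<in> sets borel" by (simp add: B_def)
  obtain r where r: "\<And>x. x \<in> B \<Longrightarrow> norm x \<le> r"
    using bounded_box[of l u] unfolding B_def bounded_iff by auto
  define \<rho> where "\<rho> = exp (L * T) * (r + norm (\<phi> T 0))"
  have pre: "norm x \<le> \<rho>" if "\<phi> T x \<in> B" for x
    unfolding \<rho>_def by (rule flow_proper[OF T]) (use r[OF that] in auto)
  define g where "g = (\<lambda>(n::nat) x. min 1 (real n * infdist x (- B)))"
  have g01: "0 \<le> g n x" "g n x \<le> 1" for n x by (auto simp: g_def infdist_nonneg)
  have gout: "g n x = 0" if "x \<notin> B" for n x using that by (simp add: g_def)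
  have glip: "(real n)-lipschitz_on UNIV (g n)" for n
  proof (rule lipschitz_onI)
    fix x y
    have "dist (g n x) (g n y) \<le> \<bar>real n * infdist x (- B) - real n * infdist y (- B)\<bar>"
      by (simp add: g_def dist_real_def min_def)
    also have "\<dots> = real n * \<bar>infdist x (- B) - infdist y (- B)\<bar>"
      by (simp add: abs_mult flip: right_diff_distrib)
    also have "\<dots> \<le> real n * dist x y" by (intro mult_left_mono infdist_triangle_abs) simp
    finally show "dist (g n x) (g n y) \<le> real n * dist x y" .
  qed simp
  have [measurable]: "g n \<in> borel_measurable borel" for n
    by (intro borel_measurable_continuous_onI lipschitz_on_continuous_on[OF glip])
  have glim: "(\<lambda>n. g n x) \<longlonglongrightarrow> indicator B x" for x
  proof (cases "x \<in> B")
    case True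
    have "- B \<noteq> {}" using bounded_box[of l u] not_bounded_UNIV by (metis B_def Compl_empty_eq double_compl)
    then have d: "0 < infdist x (- B)"
      using True by (intro infdist_pos_not_in_closed) (auto simp: B_def open_box)
    have "\<forall>\<^sub>F n in sequentially. real n \<ge> 1 / infdist x (- B)"
      by (rule eventually_sequentiallyI[of "nat \<lceil>1 / infdist x (- B)\<rceil>"]) linarith
    then have "\<forall>\<^sub>F n in sequentially. g n x = indicator B x"
      by eventually_elim (use d True in \<open>simp add: g_def field_simps\<close>)
    then show ?thesis by (rule tendsto_eventually)
  qed (simp add: gout)
  have fin: "emeasure lborel A < \<infinity>" if "\<And>x. x \<in> A \<Longrightarrow> norm x \<le> c" for A :: "'a set" and c
    using that by (intro emeasure_bounded_finite) (auto simp: bounded_iff)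
  define A where "A = {x. \<phi> T x \<in> B}"
  have [measurable]: "A \<in> sets borel" unfolding A_def by measurable
  have finA: "emeasure lborel A < \<infinity>" using pre by (intro fin) (auto simp: A_def)
  have finB: "emeasure lborel B < \<infinity>" using r by (intro fin) auto
  have "(\<lambda>n. \<integral>x. g n x \<partial>lborel) \<longlonglongrightarrow> (\<integral>x. indicator B x \<partial>lborel)"
    by (rule integral_dominated_convergence[where w = "indicator B"])
       (use finB glim g01 gout in \<open>auto simp: indicator_def\<close>)
  moreover have "(\<lambda>n. \<integral>x. g n (\<phi> T x) \<partial>lborel) \<longlonglongrightarrow> (\<integral>x. indicator A x \<partial>lborel)"
  proof (rule integral_dominated_convergence[where w = "indicator A"])
    show "AE x in lborel. (\<lambda>n. g n (\<phi> T x)) \<longlonglongrightarrow> indicator A x"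
      using glim[of "\<phi> T _"] by (auto simp: A_def indicator_def)
  qed (use finA g01 gout in \<open>auto simp: indicator_def A_def\<close>)
  moreover have "(\<integral>x. g n (\<phi> T x) \<partial>lborel) = (\<integral>x. g n x \<partial>lborel)" for n
  proof (rule integral_transport[OF div T glip])
    show "g n x = 0" if "norm x > r" for x using r[of x] that gout[of x n] by linarith
  qed
  ultimately have "measure lborel A = measure lborel B"
    using LIMSEQ_unique by fastforce
  then have "emeasure lborel A = emeasure lborel B"
    using finA finB by (simp add: emeasure_eq_ennreal_measure)
  moreover have "emeasure (distr lborel borel (\<phi> T)) B = emeasure lborel A"
    by (subst emeasure_distr) (auto simp: A_def vimage_def)
  ultimately show "emeasure (distr lborel borel (\<phi> T)) (box l u) = ennreal (\<Prod>b\<in>Basis. (u - l) \<bullet> b)"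
    using lu by (simp add: B_def)
qed simp

end

subsection \<open>Oscillation over balls\<close>

text \<open>The convex function s powr p lies above its tangent at A. Both negative terms are moved
  across, so that the inequality carries over to \<open>ennreal\<close>; for p > 1 it is Young's
  inequality with the conjugate exponent.\<close>

lemma powr_tangent:
  fixes s A p :: real
  assumes s: "0 \<le> s" and A: "0 < A" and p: "1 \<le> p"
  shows "A powr p + p * A powr (p - 1) * s \<le> s powr p + p * A powr p"
proof (cases "p = 1")
  case True then show ?thesis using assms by simp
next
  case False
  then have p1: "1 < p" using p by simp
  define q where "q = p / (p - 1)"
  have q: "1 < q" "1 / p + 1 / q = 1" using p1 by (auto simp: q_def field_simps)
  have "s * A powr (p - 1) \<le> s powr p / p + (A powr (p - 1)) powr q / q"
    by (rule Youngs_inequality) (use p1 q s in auto)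
  also have "(A powr (p - 1)) powr q = A powr p"
    using p1 by (simp add: powr_powr q_def)
  finally have "p * (s * A powr (p - 1)) \<le> p * (s powr p / p + A powr p / q)"
    using p1 by (intro mult_left_mono) auto
  also have "\<dots> = s powr p + (p - 1) * A powr p"
    using p1 by (simp add: q_def field_simps)
  finally show ?thesis by (simp add: algebra_simps)
qed

text \<open>Jensen's inequality, by integrating the tangent inequality at the \<open>L\<^sup>1\<close> mean of \<open>g - c\<close>.\<close>
lemma average_diff_le:
  fixes g :: "'b \<Rightarrow> real"
  assumes B [measurable]: "B \<in> sets M" and fin: "emeasure M B < \<infinity>" and m: "0 < measure M B"
    and g: "set_integrable M B g" and p: "1 \<le> p" and S: "0 \<le> S"
    and bound: "(\<integral>\<^sup>+y. indicator B y * ennreal (\<bar>g y - c\<bar> powr p) \<partial>M) \<le> ennreal (measure M B * S powr p)"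
  shows "\<bar>(LINT y:B|M. g y) / measure M B - c\<bar> \<le> S"
proof -
  let ?m = "measure M B"
  have cint: "set_integrable M B (\<lambda>y. c)" using fin by (simp add: set_integrable_def less_top)
  have gc: "set_integrable M B (\<lambda>y. g y - c)" by (rule set_integral_diff(1)[OF g cint])
  then have gc_abs: "set_integrable M B (\<lambda>y. \<bar>g y - c\<bar>)" by (rule set_integrable_abs)
  define A where "A = (LINT y:B|M. \<bar>g y - c\<bar>) / ?m"
  have "(LINT y:B|M. g y) / ?m - c = (LINT y:B|M. g y - c) / ?m"
  proof -
    have "(LINT y:B|M. c) = c * ?m" by (simp add: set_lebesgue_integral_def)
    then have "(LINT y:B|M. g y - c) = (LINT y:B|M. g y) - c * ?m"
      by (simp only: set_integral_diff(2)[OF g cint])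
    then show ?thesis using m by (simp add: diff_divide_distrib)
  qed
  also have "\<bar>\<dots>\<bar> \<le> A"
  proof -
    have "norm (LINT y:B|M. g y - c) \<le> (LINT y:B|M. norm (g y - c))"
      by (rule set_integral_norm_bound[OF gc])
    then show ?thesis using m by (simp add: A_def divide_right_mono abs_divide)
  qed
  finally have le_A: "\<bar>(LINT y:B|M. g y) / ?m - c\<bar> \<le> A" .
  have "A \<le> S"
  proof (rule ccontr)
    \<comment> \<open>Arguing by contradiction makes A positive, as the tangent inequality
      requires.\<close>
    assume "\<not> A \<le> S"
    then have A: "0 < A" "S < A" using S by auto
    have [measurable]: "(\<lambda>y. indicator B y * (g y - c)) \<in> borel_measurable M"
      using gc by (simp add: set_integrable_def borel_measurable_integrable)
    let ?k = "p * A powr (p - 1)"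
    have k: "0 \<le> ?k" using p A by simp
    have nnA: "(\<integral>\<^sup>+y. indicator B y * ennreal \<bar>g y - c\<bar> \<partial>M) = ennreal (A * ?m)"
    proof -
      have "(\<integral>\<^sup>+y. indicator B y * ennreal \<bar>g y - c\<bar> \<partial>M) = (\<integral>\<^sup>+y. ennreal (indicator B y * \<bar>g y - c\<bar>) \<partial>M)"
        by (intro nn_integral_cong) (auto simp: indicator_def)
      also have "\<dots> = ennreal (\<integral>y. indicator B y * \<bar>g y - c\<bar> \<partial>M)"
        using gc_abs by (intro nn_integral_eq_integral) (auto simp: set_integrable_def)
      finally show ?thesis using m by (simp add: A_def set_lebesgue_integral_def)
    qed
    have const: "(\<integral>\<^sup>+y. indicator B y * ennreal K \<partial>M) = ennreal (?m * K)" if "0 \<le> K" for K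
      using fin that by (simp add: nn_integral_multc emeasure_eq_ennreal_measure ennreal_mult' less_top)
    have m1: "(\<lambda>y. indicator B y * ennreal \<bar>g y - c\<bar>) \<in> borel_measurable M"
    proof -
      have "(\<lambda>y. ennreal \<bar>indicator B y * (g y - c)\<bar>) \<in> borel_measurable M" by measurable
      also have "(\<lambda>y. ennreal \<bar>indicator B y * (g y - c)\<bar>) = (\<lambda>y. indicator B y * ennreal \<bar>g y - c\<bar>)"
        by (auto simp: fun_eq_iff indicator_def)
      finally show ?thesis .
    qed
    have m2: "(\<lambda>y. indicator B y * ennreal (\<bar>g y - c\<bar> powr p)) \<in> borel_measurable M"
    proof -
      have "(\<lambda>y. indicator B y * ennreal (\<bar>indicator B y * (g y - c)\<bar> powr p)) \<in> borel_measurable M" by measurable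
      also have "(\<lambda>y. indicator B y * ennreal (\<bar>indicator B y * (g y - c)\<bar> powr p))
          = (\<lambda>y. indicator B y * ennreal (\<bar>g y - c\<bar> powr p))"
        by (auto simp: fun_eq_iff indicator_def)
      finally show ?thesis .
    qed
    have "ennreal (?m * A powr p) + ennreal ?k * ennreal (A * ?m)
      = (\<integral>\<^sup>+y. indicator B y * ennreal (A powr p) + ennreal ?k * (indicator B y * ennreal \<bar>g y - c\<bar>) \<partial>M)"
      using m1 by (simp add: nn_integral_add nn_integral_cmult nnA const)
    also have "\<dots> \<le> (\<integral>\<^sup>+y. indicator B y * ennreal (\<bar>g y - c\<bar> powr p) + indicator B y * ennreal (p * A powr p) \<partial>M)"
    proof (intro nn_integral_mono)
      fix y
      have "ennreal (A powr p) + ennreal ?k * ennreal \<bar>g y - c\<bar> \<le> ennreal (\<bar>g y - c\<bar> powr p) + ennreal (p * A powr p)"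
        using powr_tangent[OF _ A(1) p, of "\<bar>g y - c\<bar>"] k p
        by (simp flip: ennreal_plus ennreal_mult add: ennreal_leI)
      then show "indicator B y * ennreal (A powr p) + ennreal ?k * (indicator B y * ennreal \<bar>g y - c\<bar>)
          \<le> indicator B y * ennreal (\<bar>g y - c\<bar> powr p) + indicator B y * ennreal (p * A powr p)"
        by (simp add: indicator_def)
    qed
    also have "\<dots> = (\<integral>\<^sup>+y. indicator B y * ennreal (\<bar>g y - c\<bar> powr p) \<partial>M) + ennreal (?m * (p * A powr p))"
      using m2 p by (simp add: nn_integral_add const)
    also have "\<dots> \<le> ennreal (?m * S powr p) + ennreal (?m * (p * A powr p))"
      by (intro add_right_mono bound)
    finally have "ennreal (?m * A powr p + ?k * (A * ?m)) \<le> ennreal (?m * S powr p + ?m * (p * A powr p))"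
      using m A p k by (simp add: ennreal_plus ennreal_mult)
    then have "?m * A powr p + ?k * (A * ?m) \<le> ?m * S powr p + ?m * (p * A powr p)"
      using m p by (subst (asm) ennreal_le_iff) auto
    \<comment> \<open>The tangent point is the mean itself, so the linear terms cancel and A powr p
      <= S powr p remains.\<close>
    moreover have "?k * (A * ?m) = ?m * (p * A powr p)"
      using powr_add[of A "p - 1" 1] A by simp
    ultimately have "A powr p \<le> S powr p" using m by simp
    moreover have "S powr p < A powr p" using A S p by (intro powr_less_mono2) auto
    ultimately show False by simp
  qed
  then show ?thesis using le_A by simp
qed

text \<open>From |g - b| <= 2 max |g - c| S one gets a factor 2 powr p and two terms, and 2 * 2 powr
  p <= 4 powr p because p >= 1. It serves to pass from a mean to a reference value and back.\<close>

lemma recenter_le: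
  fixes g :: "'b \<Rightarrow> real"
  assumes [measurable]: "B \<in> sets M" "g \<in> borel_measurable M" and fin: "emeasure M B < \<infinity>"
    and p: "1 \<le> p" and S: "0 \<le> S"
    and bound: "(\<integral>\<^sup>+y. indicator B y * ennreal (\<bar>g y - c\<bar> powr p) \<partial>M) \<le> ennreal (measure M B * S powr p)"
    and b: "\<bar>b - c\<bar> \<le> S"
  shows "(\<integral>\<^sup>+y. indicator B y * ennreal (\<bar>g y - b\<bar> powr p) \<partial>M) \<le> ennreal (measure M B * (4 * S) powr p)"
proof -
  let ?m = "measure M B"
  have pt: "\<bar>g y - b\<bar> powr p \<le> 2 powr p * (\<bar>g y - c\<bar> powr p + S powr p)" for y
  proof -
    have "\<bar>g y - b\<bar> \<le> \<bar>g y - c\<bar> + S" using b by linarith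
    also have "\<dots> \<le> 2 * max \<bar>g y - c\<bar> S"
      by (cases "\<bar>g y - c\<bar> \<le> S") (auto simp: max_def)
    finally have "\<bar>g y - b\<bar> powr p \<le> (2 * max \<bar>g y - c\<bar> S) powr p"
      using p by (intro powr_mono2) auto
    also have "\<dots> = 2 powr p * (max \<bar>g y - c\<bar> S) powr p" using S by (simp add: powr_mult)
    also have "\<dots> \<le> 2 powr p * (\<bar>g y - c\<bar> powr p + S powr p)"
      by (intro mult_left_mono) (auto simp: max_def)
    finally show ?thesis .
  qed
  have "(\<integral>\<^sup>+y. indicator B y * ennreal (\<bar>g y - b\<bar> powr p) \<partial>M)
     \<le> (\<integral>\<^sup>+y. ennreal (2 powr p) * (indicator B y * ennreal (\<bar>g y - c\<bar> powr p) + ennreal (S powr p) * indicator B y) \<partial>M)"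
  proof (intro nn_integral_mono)
    fix y
    have "ennreal (\<bar>g y - b\<bar> powr p) \<le> ennreal (2 powr p) * (ennreal (\<bar>g y - c\<bar> powr p) + ennreal (S powr p))"
      using pt[of y] by (simp flip: ennreal_plus ennreal_mult add: ennreal_leI)
    then show "indicator B y * ennreal (\<bar>g y - b\<bar> powr p)
      \<le> ennreal (2 powr p) * (indicator B y * ennreal (\<bar>g y - c\<bar> powr p) + ennreal (S powr p) * indicator B y)"
      by (simp add: indicator_def)
  qed
  also have "\<dots> = ennreal (2 powr p) * ((\<integral>\<^sup>+y. indicator B y * ennreal (\<bar>g y - c\<bar> powr p) \<partial>M) + ennreal (S powr p) * ennreal ?m)"
    using fin by (simp add: nn_integral_cmult nn_integral_add emeasure_eq_ennreal_measure less_top)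
  also have "\<dots> \<le> ennreal (2 powr p) * (ennreal (?m * S powr p) + ennreal (S powr p) * ennreal ?m)"
    by (intro mult_left_mono add_right_mono bound) simp
  also have "\<dots> = ennreal (2 powr p * (?m * S powr p + S powr p * ?m))"
    by (simp only: ennreal_plus ennreal_mult measure_nonneg powr_ge_zero mult_nonneg_nonneg add_nonneg_nonneg)
  also have "\<dots> \<le> ennreal (?m * (4 * S) powr p)"
  proof (rule ennreal_leI)
    have "2 powr 1 \<le> (2::real) powr p" using p by (intro powr_mono) auto
    then have "2 powr p * 2 \<le> 2 powr p * (2::real) powr p" by (intro mult_left_mono) auto
    also have "\<dots> = 4 powr p" using powr_mult[of 2 2 p] by simp
    finally have "(2 powr p * 2) * (?m * S powr p) \<le> 4 powr p * (?m * S powr p)"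
      by (intro mult_right_mono) auto
    then show "2 powr p * (?m * S powr p + S powr p * ?m) \<le> ?m * (4 * S) powr p"
      using S by (simp add: powr_mult algebra_simps)
  qed
  finally show ?thesis .
qed

section \<open>Ball volumes and means at different scales\<close>

definition ball_vol :: "'a::euclidean_space itself \<Rightarrow> real \<Rightarrow> real" where
  "ball_vol _ r = measure lborel (ball (0::'a) r)"

lemma measure_ball:
  fixes x :: "'a::euclidean_space"
  assumes "0 \<le> r"
  shows "measure lborel (ball x r) = r ^ DIM('a) * ball_vol TYPE('a) 1"
  using content_ball_conv_unit_ball[OF assms, of x] by (simp add: ball_vol_def)

lemma ball_vol_pos: "0 < ball_vol TYPE('a::euclidean_space) 1"
  unfolding ball_vol_def by (rule content_ball_pos) simp

lemma emeasure_ball_finite: "emeasure lborel (ball (x::'a::euclidean_space) r) < \<infinity>"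
  by (rule emeasure_bounded_finite) simp

lemma emeasure_ball:
  fixes x :: "'a::euclidean_space"
  assumes "0 \<le> r"
  shows "emeasure lborel (ball x r) = ennreal (r ^ DIM('a) * ball_vol TYPE('a) 1)"
  using emeasure_ball_finite[of x r]
  by (simp add: emeasure_eq_ennreal_measure measure_ball[OF assms] less_top)

text \<open>\<open>N\<close> is the Campanato seminorm, renormalised so that the oscillation over a ball of
  radius \<open>r\<close> is bounded by \<open>N r\<^sup>a\<close> (for \<open>sharp_norm\<close> the scale is \<open>|B|\<^bsup>a/d\<^esup>\<close> instead).\<close>
locale bounded_oscillation =
  fixes f :: "'a::euclidean_space \<Rightarrow> real" and p a N :: real
  assumes f_meas [measurable]: "f \<in> borel_measurable borel"
    and f_int: "\<And>x r. set_integrable lborel (ball x r) f"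
    and p: "1 \<le> p" and a: "0 \<le> a" and N: "0 \<le> N"
    and osc: "\<And>x r. 0 < r \<Longrightarrow>
      (\<integral>\<^sup>+y. indicator (ball x r) y *
          ennreal (\<bar>f y - (LINT y:ball x r|lborel. f y) / measure lborel (ball x r)\<bar> powr p) \<partial>lborel)
      \<le> ennreal (measure lborel (ball x r) * (N * r powr a) powr p)"
begin

definition avg :: "'a \<Rightarrow> real \<Rightarrow> real" where
  "avg x r = (LINT y:ball x r|lborel. f y) / measure lborel (ball x r)"

text \<open>On the smaller ball, f deviates from the larger mean by no more in integral than on the
  larger ball. Dividing by the smaller volume costs K = (S / s)^d, and K <= K powr p lets K enter
  the p-th power, which keeps the bound free of p. Jensen then gives the difference of the
  means.\<close>

lemma avg_subball:
  assumes s: "0 < s" and sub: "ball y s \<subseteq> ball w S"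
  shows "\<bar>avg y s - avg w S\<bar> \<le> (S / s) ^ DIM('a) * (N * S powr a)"
proof -
  have sS: "s \<le> S" using sub s by (simp add: ball_subset_ball_iff) (smt (verit) zero_le_dist)
  then have S: "0 < S" using s by simp
  have K: "1 \<le> (S / s) ^ DIM('a)" using sS s by (intro one_le_power) simp
  have NS: "0 \<le> N * S powr a" using N by simp
  let ?K = "(S / s) ^ DIM('a)"
  have ms: "measure lborel (ball w S) = ?K * measure lborel (ball y s)"
    using s S by (simp add: measure_ball power_divide)
  show ?thesis unfolding avg_def[of y s]
  proof (rule average_diff_le[where p = p])
    show "0 < measure lborel (ball y s)" using s by (rule content_ball_pos)
    have "(\<integral>\<^sup>+z. indicator (ball y s) z * ennreal (\<bar>f z - avg w S\<bar> powr p) \<partial>lborel)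
      \<le> (\<integral>\<^sup>+z. indicator (ball w S) z * ennreal (\<bar>f z - avg w S\<bar> powr p) \<partial>lborel)"
      using sub by (intro nn_integral_mono mult_right_mono) (auto simp: indicator_def)
    also have "\<dots> \<le> ennreal (measure lborel (ball w S) * (N * S powr a) powr p)"
      unfolding avg_def by (rule osc) fact
    also have "\<dots> \<le> ennreal (measure lborel (ball y s) * (?K * (N * S powr a)) powr p)"
    proof (rule ennreal_leI)
      have "?K powr 1 \<le> ?K powr p" using K p by (intro powr_mono) auto
      then have "?K \<le> ?K powr p" using K by simp
      then have "measure lborel (ball y s) * (?K * (N * S powr a) powr p)
          \<le> measure lborel (ball y s) * (?K powr p * (N * S powr a) powr p)"
        by (intro mult_left_mono mult_right_mono) auto
      then show "measure lborel (ball w S) * (N * S powr a) powr p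
          \<le> measure lborel (ball y s) * (?K * (N * S powr a)) powr p"
        using K NS unfolding ms by (subst powr_mult) (auto simp: mult_ac)
    qed
    finally show "(\<integral>\<^sup>+z. indicator (ball y s) z * ennreal (\<bar>f z - avg w S\<bar> powr p) \<partial>lborel)
      \<le> ennreal (measure lborel (ball y s) * (?K * (N * S powr a)) powr p)" .
    show "0 \<le> ?K * (N * S powr a)" using K NS by simp
  qed (use p f_int emeasure_ball_finite in auto)
qed

text \<open>Telescoping over doubled radii, each doubling having volume ratio 2^d. The increments
  are measured relative to the largest scale, so they form a geometric sum of ratio 2 powr - a,
  which also covers a = 0.\<close>

lemma avg_dyadic:
  assumes \<rho>: "0 < \<rho>"
  shows "\<bar>avg y \<rho> - avg y (2 ^ n * \<rho>)\<bar> \<le> 2 ^ DIM('a) * N * (2 ^ n * \<rho>) powr a * (\<Sum>j<n. (2 powr - a) ^ j)"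
proof (induction n)
  case (Suc n)
  let ?s = "2 ^ n * \<rho>" and ?Q = "\<Sum>j<n. (2 powr - a) ^ j"
  let ?C = "2 ^ DIM('a) * N"
  have s: "0 < ?s" using \<rho> by simp
  have "\<bar>avg y ?s - avg y (2 * ?s)\<bar> \<le> (2 * ?s / ?s) ^ DIM('a) * (N * (2 * ?s) powr a)"
    by (rule avg_subball[OF s]) (use \<rho> in \<open>intro subset_ball, simp\<close>)
  then have "\<bar>avg y ?s - avg y (2 * ?s)\<bar> \<le> ?C * (2 * ?s) powr a"
    using \<rho> by (simp add: mult.assoc)
  moreover have "?s powr a = (2 * ?s) powr a * 2 powr - a"
    using s by (simp add: powr_mult powr_minus)
  then have "?C * ?s powr a * ?Q = ?C * (2 * ?s) powr a * (2 powr - a * ?Q)" by simp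
  \<comment> \<open>The term j = 0 is split off, since j counts scales downwards from the largest
    and the new increment is the largest scale.\<close>
  moreover have "(\<Sum>j<Suc n. (2 powr - a) ^ j) = 1 + 2 powr - a * ?Q"
    by (simp only: sum.lessThan_Suc_shift sum_distrib_left power_Suc power_0)
  moreover have "2 ^ Suc n * \<rho> = 2 * ?s" by simp
  ultimately show ?case using Suc.IH
    by (simp only: distrib_left mult_1_right)
qed simp

text \<open>After n doublings around y the radius lies between R and 2 R. As y is within 2 R of w,
  one more comparison reaches the ball of radius 4 R about w, at a volume ratio of at most
  4^d.\<close>

lemma avg_chain:
  assumes \<rho>: "0 < \<rho>" and n: "R \<le> 2 ^ n * \<rho>" "2 ^ n * \<rho> \<le> 2 * R" and y: "dist y w \<le> 2 * R"
  shows "\<bar>avg y \<rho> - avg w (4 * R)\<bar>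
    \<le> 4 ^ DIM('a) * N * (4 * R) powr a * (1 + (\<Sum>j<n. (2 powr - a) ^ j))"
proof -
  let ?s = "2 ^ n * \<rho>" and ?Q = "\<Sum>j<n. (2 powr - a) ^ j"
  have s: "0 < ?s" using \<rho> by simp
  then have R: "0 < R" using n by linarith
  have Q: "0 \<le> ?Q" by (intro sum_nonneg) simp
  have "ball y ?s \<subseteq> ball w (4 * R)"
    using y n by (intro ball_subset_ball_iff[THEN iffD2]) (simp add: dist_commute)
  then have "\<bar>avg y ?s - avg w (4 * R)\<bar> \<le> (4 * R / ?s) ^ DIM('a) * (N * (4 * R) powr a)"
    by (rule avg_subball[OF s])
  also have "\<dots> \<le> 4 ^ DIM('a) * (N * (4 * R) powr a)"
    using n s R N by (intro mult_right_mono power_mono) (auto simp: divide_le_eq)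
  finally have 1: "\<bar>avg y ?s - avg w (4 * R)\<bar> \<le> 4 ^ DIM('a) * N * (4 * R) powr a * 1" by simp
  have "\<bar>avg y \<rho> - avg y ?s\<bar> \<le> 2 ^ DIM('a) * N * ?s powr a * ?Q" by (rule avg_dyadic) fact
  also have "\<dots> \<le> 4 ^ DIM('a) * N * (4 * R) powr a * ?Q"
  proof -
    have "?s powr a \<le> (4 * R) powr a"
      using n s R a by (intro powr_mono2) linarith+
    moreover have "(2::real) ^ DIM('a) \<le> 4 ^ DIM('a)" by (rule power_mono) auto
    ultimately show ?thesis
      using N Q by (intro mult_right_mono mult_mono) auto
  qed
  finally show ?thesis using 1 by (simp only: distrib_left)
qed

text \<open>Covering \<open>X ` ball x r\<close> by balls of radius \<open>\<rho>\<close> is replaced by an average over all such balls: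
  Tonelli turns the integral of \<open>h \<circ> X\<close> into integrals of \<open>h\<close> over balls with centre in a
  \<open>\<rho>\<close>-neighbourhood \<open>W\<close> of \<open>X ` ball x r\<close>, and \<open>X -` W \<subseteq> ball x (2 * r)\<close>.\<close>
lemma compose_osc_aux:
  fixes X :: "'a \<Rightarrow> 'a"
  assumes X [measurable]: "X \<in> borel_measurable borel" and mp: "distr lborel borel X = lborel"
    and E: "1 \<le> E" and X_ge: "\<And>x y. dist x y \<le> E * dist (X x) (X y)"
    and r: "0 < r" and \<rho>: "\<rho> = r / E" and K: "0 \<le> K"
    and h: "h \<in> borel_measurable borel"
    and bound: "\<And>x' y. x' \<in> ball x r \<Longrightarrow> dist y (X x') < \<rho> \<Longrightarrow>
      (\<integral>\<^sup>+z. indicator (ball y \<rho>) z * h z \<partial>lborel) \<le> ennreal (measure lborel (ball y \<rho>) * K)"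
  shows "(\<integral>\<^sup>+x'. indicator (ball x r) x' * h (X x') \<partial>lborel) \<le> ennreal (2 ^ DIM('a) * measure lborel (ball x r) * K)"
proof -
  note [measurable] = h
  have hX [measurable]: "(\<lambda>x'. h (X x')) \<in> borel_measurable borel"
    by (rule measurable_compose[OF X h])
  have [measurable]: "(\<lambda>x'. h (X x') * indicator (ball x r) x') \<in> borel_measurable borel"
    by (intro borel_measurable_times_ennreal hX borel_measurable_indicator) simp
  let ?d = "DIM('a)" and ?\<omega> = "ball_vol TYPE('a) 1"
  have \<rho>0: "0 < \<rho>" using r E by (simp add: \<rho>)
  define W where "W = (\<Union>x'\<in>ball x r. ball (X x') \<rho>)"
  have [measurable]: "W \<in> sets borel" unfolding W_def by (intro borel_open open_UN) auto
  have dist_meas [measurable]: "{q \<in> space (lborel \<Otimes>\<^sub>M lborel). dist (snd q) (X (fst q)) < \<rho>} \<in> sets (lborel \<Otimes>\<^sub>M lborel)"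
    by measurable
  have W_small: "emeasure lborel W \<le> ennreal ((2 * r) ^ ?d * ?\<omega>)"
  proof -
    have "emeasure lborel W = emeasure (distr lborel borel X) W" by (simp add: mp)
    also have "\<dots> = emeasure lborel {x'. X x' \<in> W}"
      by (subst emeasure_distr) (auto simp: vimage_def)
    also have "\<dots> \<le> emeasure lborel (ball x (2 * r))"
    proof (rule emeasure_mono)
      show "{x'. X x' \<in> W} \<subseteq> ball x (2 * r)"
      proof
        fix z assume "z \<in> {x'. X x' \<in> W}"
        then obtain x' where x': "x' \<in> ball x r" "dist (X x') (X z) < \<rho>" by (auto simp: W_def)
        have "dist x' z \<le> E * dist (X x') (X z)" by (rule X_ge)
        also have "\<dots> < E * \<rho>" using x'(2) E by (intro mult_strict_left_mono) auto
        also have "\<dots> = r" using E by (simp add: \<rho>)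
        finally show "z \<in> ball x (2 * r)"
          using x'(1) dist_triangle[of x z x'] by simp
      qed
    qed simp
    also have "\<dots> = ennreal ((2 * r) ^ ?d * ?\<omega>)" using r by (intro emeasure_ball) simp
    finally show ?thesis .
  qed
  let ?V = "ennreal (\<rho> ^ ?d * ?\<omega>)"
  \<comment> \<open>The volume of a ball of radius \<rho> is written as an integral over the centres
    y that lie within \<rho> of X x'. It cancels at the end.\<close>
  have "?V * (\<integral>\<^sup>+x'. indicator (ball x r) x' * h (X x') \<partial>lborel)
    = (\<integral>\<^sup>+x'. (\<integral>\<^sup>+y. indicator (ball x r) x' * h (X x') * indicator (ball (X x') \<rho>) y \<partial>lborel) \<partial>lborel)"
  proof -
    have "?V * (\<integral>\<^sup>+x'. indicator (ball x r) x' * h (X x') \<partial>lborel)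
      = (\<integral>\<^sup>+x'. indicator (ball x r) x' * h (X x') * ?V \<partial>lborel)"
      by (subst nn_integral_multc) (simp_all add: mult.commute)
    also have "\<dots> = (\<integral>\<^sup>+x'. (\<integral>\<^sup>+y. indicator (ball x r) x' * h (X x') * indicator (ball (X x') \<rho>) y \<partial>lborel) \<partial>lborel)"
      using \<rho>0 by (intro nn_integral_cong) (simp only: nn_integral_cmult_indicator borel_open open_ball sets_lborel emeasure_ball less_imp_le)
    finally show ?thesis .
  qed
  also have "\<dots> \<le> (\<integral>\<^sup>+x'. (\<integral>\<^sup>+y. indicator W y * (of_bool (dist y (X x') < \<rho>) * h (X x')) \<partial>lborel) \<partial>lborel)"
    by (intro nn_integral_mono) (auto simp: indicator_def W_def dist_commute)
  also have "\<dots> = (\<integral>\<^sup>+y. (\<integral>\<^sup>+x'. indicator W y * (of_bool (dist y (X x') < \<rho>) * h (X x')) \<partial>lborel) \<partial>lborel)"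
    by (rule lborel_pair.Fubini') measurable
  also have "\<dots> = (\<integral>\<^sup>+y. indicator W y * (\<integral>\<^sup>+z. indicator (ball y \<rho>) z * h z \<partial>lborel) \<partial>lborel)"
  proof (rule nn_integral_cong)
    fix y
    \<comment> \<open>Measure preservation enters a second time, as the change of variables z = X
      x'; the first time it bounded the volume of \<open>W\<close>.\<close>
    have "(\<integral>\<^sup>+z. indicator (ball y \<rho>) z * h z \<partial>lborel) = (\<integral>\<^sup>+z. indicator (ball y \<rho>) z * h z \<partial>distr lborel borel X)"
      by (simp add: mp)
    also have "\<dots> = (\<integral>\<^sup>+x'. indicator (ball y \<rho>) (X x') * h (X x') \<partial>lborel)"
      by (rule nn_integral_distr) (use X h in \<open>auto intro!: borel_measurable_times_ennreal borel_measurable_indicator\<close>)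
    finally show "(\<integral>\<^sup>+x'. indicator W y * (of_bool (dist y (X x') < \<rho>) * h (X x')) \<partial>lborel)
      = indicator W y * (\<integral>\<^sup>+z. indicator (ball y \<rho>) z * h z \<partial>lborel)"
      by (simp add: nn_integral_cmult indicator_def of_bool_def)
  qed
  also have "\<dots> \<le> (\<integral>\<^sup>+y. indicator W y * ennreal (\<rho> ^ ?d * ?\<omega> * K) \<partial>lborel)"
  proof (rule nn_integral_mono)
    fix y
    show "indicator W y * (\<integral>\<^sup>+z. indicator (ball y \<rho>) z * h z \<partial>lborel) \<le> indicator W y * ennreal (\<rho> ^ ?d * ?\<omega> * K)"
    proof (cases "y \<in> W")
      case True
      then obtain x' where "x' \<in> ball x r" "dist y (X x') < \<rho>" by (auto simp: W_def dist_commute)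
      from bound[OF this] show ?thesis using True \<rho>0 by (simp add: measure_ball)
    qed simp
  qed
  also have "\<dots> = emeasure lborel W * ennreal (\<rho> ^ ?d * ?\<omega> * K)"
    by (simp add: nn_integral_multc)
  also have "\<dots> \<le> ennreal ((2 * r) ^ ?d * ?\<omega>) * ennreal (\<rho> ^ ?d * ?\<omega> * K)"
    by (rule mult_right_mono[OF W_small]) simp
  also have "\<dots> = ?V * ennreal (2 ^ ?d * measure lborel (ball x r) * K)"
    using r \<rho>0 K ball_vol_pos[where 'a = 'a]
    by (simp add: measure_ball power_mult_distrib mult_ac flip: ennreal_mult)
  finally show ?thesis
    using \<rho>0 ball_vol_pos[where 'a = 'a] by (subst (asm) ennreal_mult_le_mult_iff) auto
qed

text \<open>All small balls are compared with one value c, a mean over a ball about X x. The radii E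
  r and r / E have ratio E^2, which explains the condition on n. In the constant, 4^d 4 powr a E
  powr a and the sum come from \<open>avg_chain\<close>, 2^d from averaging over small balls, and a
  factor 4 from each recentring: small mean to c, then c to the mean of f o X.\<close>

lemma compose_osc:
  fixes X :: "'a \<Rightarrow> 'a"
  assumes X [measurable]: "X \<in> borel_measurable borel" and mp: "distr lborel borel X = lborel"
    and E: "1 \<le> E" and X_ge: "\<And>x y. dist x y \<le> E * dist (X x) (X y)"
    and X_le: "\<And>x y. dist (X x) (X y) \<le> E * dist x y"
    and n: "E\<^sup>2 \<le> 2 ^ n" "2 ^ n \<le> 2 * E\<^sup>2"
  shows "bounded_oscillation (\<lambda>x. f (X x)) p a
    (16 * 2 ^ DIM('a) * 4 ^ DIM('a) * 4 powr a * E powr a * (1 + (\<Sum>j<n. (2 powr - a) ^ j)) * N)"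
proof
  let ?Q = "1 + (\<Sum>j<n. (2 powr - a) ^ j)" and ?d = "DIM('a)"
  show U_meas: "(\<lambda>x. f (X x)) \<in> borel_measurable borel" by measurable
  have Q: "1 \<le> ?Q" by (simp add: sum_nonneg)
  show "0 \<le> 16 * 2 ^ ?d * 4 ^ ?d * 4 powr a * E powr a * ?Q * N"
    using N Q by (intro mult_nonneg_nonneg) auto
  have U_int: "set_integrable lborel (ball x r) (\<lambda>x. f (X x))" for x r
  proof (cases "0 < r")
    case True
    have "set_integrable lborel (ball (X x) (E * r)) f" by (rule f_int)
    then have "integrable (distr lborel borel X) (\<lambda>z. indicator (ball (X x) (E * r)) z *\<^sub>R f z)"
      by (simp add: mp set_integrable_def)
    then have "integrable lborel (\<lambda>z. indicator (ball (X x) (E * r)) (X z) *\<^sub>R f (X z))"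
      by (subst (asm) integrable_distr_eq) (use X in \<open>auto intro!: borel_measurable_times borel_measurable_indicator\<close>)
    then show ?thesis unfolding set_integrable_def
    proof (rule Bochner_Integration.integrable_bound)
      show "AE z in lborel. norm (indicator (ball x r) z *\<^sub>R f (X z)) \<le> norm (indicator (ball (X x) (E * r)) (X z) *\<^sub>R f (X z))"
      proof (intro AE_I2)
        fix z
        have "X z \<in> ball (X x) (E * r)" if "z \<in> ball x r"
        proof -
          have "E * dist x z < E * r" using that E by (intro mult_strict_left_mono) auto
          then show ?thesis using X_le[of x z] by simp
        qed
        then show "norm (indicator (ball x r) z *\<^sub>R f (X z)) \<le> norm (indicator (ball (X x) (E * r)) (X z) *\<^sub>R f (X z))"
          by (auto simp: indicator_def)
      qed
      show "(\<lambda>z. indicator (ball x r) z *\<^sub>R f (X z)) \<in> borel_measurable lborel"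
        using U_meas by (auto intro!: borel_measurable_times borel_measurable_indicator)
    qed
  next
    case False
    then have "ball x r = {}" by simp
    then show ?thesis unfolding set_integrable_def by (simp only: indicator_simps empty_iff) simp
  qed
  then show "set_integrable lborel (ball x r) (\<lambda>x. f (X x))" for x r .
  fix x :: 'a and r :: real assume r: "0 < r"
  let ?R = "E * r" and ?\<rho> = "r / E"
  let ?T = "4 ^ ?d * N * (4 * ?R) powr a * ?Q"
  define c where "c = avg (X x) (4 * ?R)"
  have \<rho>: "0 < ?\<rho>" "?\<rho> \<le> ?R"
  proof -
    show "0 < ?\<rho>" using r E by simp
    have "r * 1 \<le> r * (E * E)" using r E mult_mono[of 1 E 1 E] by (intro mult_left_mono) auto
    then show "?\<rho> \<le> ?R" using E by (simp add: field_simps)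
  qed
  have nR: "?R \<le> 2 ^ n * ?\<rho>" "2 ^ n * ?\<rho> \<le> 2 * ?R"
    using n r E by (auto simp: field_simps power2_eq_square)
  have T: "0 \<le> ?T" using N Q by (intro mult_nonneg_nonneg) auto
  have local: "(\<integral>\<^sup>+z. indicator (ball y ?\<rho>) z * ennreal (\<bar>f z - c\<bar> powr p) \<partial>lborel)
      \<le> ennreal (measure lborel (ball y ?\<rho>) * (4 * ?T) powr p)"
    if x': "x' \<in> ball x r" and y: "dist y (X x') < ?\<rho>" for x' y
  proof (rule recenter_le[where c = "avg y ?\<rho>"])
    have "?\<rho> \<le> 4 * ?R" using \<rho> by linarith
    then have "N * ?\<rho> powr a \<le> N * (4 * ?R) powr a"
      using \<rho>(1) a N by (intro mult_left_mono powr_mono2) auto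
    also have "\<dots> \<le> (4 ^ ?d * ?Q) * (N * (4 * ?R) powr a)"
    proof -
      have "1 * 1 \<le> 4 ^ ?d * ?Q" using Q by (intro mult_mono) auto
      from mult_right_mono[OF this, of "N * (4 * ?R) powr a"] show ?thesis using N by simp
    qed
    finally have le: "N * ?\<rho> powr a \<le> ?T" by (simp add: mult_ac)
    have "(\<integral>\<^sup>+z. indicator (ball y ?\<rho>) z * ennreal (\<bar>f z - avg y ?\<rho>\<bar> powr p) \<partial>lborel)
      \<le> ennreal (measure lborel (ball y ?\<rho>) * (N * ?\<rho> powr a) powr p)"
      unfolding avg_def by (rule osc) fact
    also have "\<dots> \<le> ennreal (measure lborel (ball y ?\<rho>) * ?T powr p)"
      using le p N by (intro ennreal_leI mult_left_mono powr_mono2) auto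
    finally show "(\<integral>\<^sup>+z. indicator (ball y ?\<rho>) z * ennreal (\<bar>f z - avg y ?\<rho>\<bar> powr p) \<partial>lborel)
      \<le> ennreal (measure lborel (ball y ?\<rho>) * ?T powr p)" .
    have "dist x x' \<le> r" using x' by simp
    then have "E * dist x x' \<le> ?R" using E by (intro mult_left_mono) auto
    then have "dist y (X x) \<le> 2 * ?R"
      using y \<rho> X_le[of x x'] dist_triangle[of y "X x" "X x'"] by (simp add: dist_commute)
    from avg_chain[OF \<rho>(1) nR this] show "\<bar>c - avg y ?\<rho>\<bar> \<le> ?T"
      by (simp add: c_def abs_minus_commute)
  qed (use p T emeasure_ball_finite in auto)
  let ?S = "4 * 2 ^ ?d * ?T"
  have S: "0 \<le> ?S" using T by simp
  have "(\<integral>\<^sup>+x'. indicator (ball x r) x' * ennreal (\<bar>f (X x') - c\<bar> powr p) \<partial>lborel)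
    \<le> ennreal (2 ^ ?d * measure lborel (ball x r) * (4 * ?T) powr p)"
    by (rule compose_osc_aux[OF X mp E X_ge r refl _ _ local]) auto
  also have "\<dots> \<le> ennreal (measure lborel (ball x r) * ?S powr p)"
  proof (rule ennreal_leI)
    \<comment> \<open>Since p >= 1, the factor 2^d can be pulled into the p-th power.\<close>
    have "(2 ^ ?d) powr 1 \<le> (2 ^ ?d :: real) powr p" using p by (intro powr_mono) auto
    then have "2 ^ ?d * (measure lborel (ball x r) * (4 * ?T) powr p)
        \<le> (2 ^ ?d) powr p * (measure lborel (ball x r) * (4 * ?T) powr p)"
      by (intro mult_right_mono) auto
    also have "\<dots> = measure lborel (ball x r) * ?S powr p"
      using T powr_mult[of "2 ^ ?d" "4 * ?T" p] by (simp add: mult_ac)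
    finally show "2 ^ ?d * measure lborel (ball x r) * (4 * ?T) powr p \<le> measure lborel (ball x r) * ?S powr p"
      by (simp add: mult_ac)
  qed
  finally have Uc: "(\<integral>\<^sup>+x'. indicator (ball x r) x' * ennreal (\<bar>f (X x') - c\<bar> powr p) \<partial>lborel)
    \<le> ennreal (measure lborel (ball x r) * ?S powr p)" .
  have "\<bar>(LINT y:ball x r|lborel. f (X y)) / measure lborel (ball x r) - c\<bar> \<le> ?S"
    by (rule average_diff_le[OF _ emeasure_ball_finite _ U_int p S Uc]) (use r content_ball_pos in auto)
  from recenter_le[OF _ _ emeasure_ball_finite p S Uc this]
  have "(\<integral>\<^sup>+y. indicator (ball x r) y * ennreal (\<bar>f (X y) - (LINT y:ball x r|lborel. f (X y)) / measure lborel (ball x r)\<bar> powr p) \<partial>lborel)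
      \<le> ennreal (measure lborel (ball x r) * (4 * ?S) powr p)" by simp
  also have "4 * ?S = 16 * 2 ^ ?d * 4 ^ ?d * 4 powr a * E powr a * ?Q * N * r powr a"
    using r E by (simp add: powr_mult mult_ac)
  finally show "(\<integral>\<^sup>+y. indicator (ball x r) y * ennreal (\<bar>f (X y) - (LINT y:ball x r|lborel. f (X y)) / measure lborel (ball x r)\<bar> powr p) \<partial>lborel)
      \<le> ennreal (measure lborel (ball x r) * (16 * 2 ^ ?d * 4 ^ ?d * 4 powr a * E powr a * ?Q * N * r powr a) powr p)" .
qed (use p a in auto)

end

subsection \<open>The seminorms of the composed function\<close>

text \<open>The infimum is attained: for distinct x and y the difference quotient is a lower bound
  of all admissible constants. The flow estimates can thus be used with L =
  \<open>lip_norm v\<close>.\<close>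

lemma lip_norm_lipschitz:
  assumes "\<exists>L. L-lipschitz_on UNIV v"
  shows "(lip_norm v)-lipschitz_on UNIV v"
proof (rule lipschitz_onI)
  obtain L0 where L0: "L0-lipschitz_on UNIV v" using assms by blast
  have nonempty: "{L. L-lipschitz_on UNIV v} \<noteq> {}" using L0 by blast
  show "0 \<le> lip_norm v"
    unfolding lip_norm_def by (rule cInf_greatest[OF nonempty]) (auto intro: lipschitz_on_nonneg)
  fix x y
  show "dist (v x) (v y) \<le> lip_norm v * dist x y"
  proof (cases "x = y")
    case False
    then have d: "0 < dist x y" by simp
    have "dist (v x) (v y) / dist x y \<le> lip_norm v"
      unfolding lip_norm_def
    proof (rule cInf_greatest[OF nonempty])
      fix L assume "L \<in> {L. L-lipschitz_on UNIV v}"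
      then show "dist (v x) (v y) / dist x y \<le> L"
        using lipschitz_onD[of L UNIV v x y] d by (simp add: divide_le_eq)
    qed
    then show ?thesis using d by (simp add: divide_le_eq)
  qed simp
qed

section \<open>Borel representatives and the normalisation of the seminorm\<close>

lemma locally_integrable_measurable:
  assumes "locally_integrable f"
  shows "f \<in> borel_measurable lebesgue"
proof (rule borel_measurable_LIMSEQ_real)
  show "(\<lambda>n. indicator (cball 0 (real n)) x *\<^sub>R f x) \<longlonglongrightarrow> f x" for x
  proof (rule tendsto_eventually, rule eventually_sequentiallyI)
    fix n assume "n \<ge> nat \<lceil>norm x\<rceil>"
    then have "norm x \<le> real n" by linarith
    then show "indicator (cball 0 (real n)) x *\<^sub>R f x = f x" by simp
  qed
  show "(\<lambda>x. indicator (cball 0 (real n)) x *\<^sub>R f x) \<in> borel_measurable lebesgue" for n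
    using assms by (auto simp: locally_integrable_def set_integrable_def intro!: borel_measurable_integrable)
qed

lemma locally_integrable_ball:
  assumes "locally_integrable f"
  shows "set_integrable lebesgue (ball x r) f"
proof (rule set_integrable_subset)
  show "set_integrable lebesgue (cball x r) f" using assms by (simp add: locally_integrable_def)
qed auto

lemma locally_integrableI_ball:
  fixes f :: "'a::euclidean_space \<Rightarrow> real"
  assumes "\<And>r. set_integrable lebesgue (ball 0 r) f"
  shows "locally_integrable f"
  unfolding locally_integrable_def
proof (intro allI impI)
  fix K :: "'a set" assume K: "compact K"
  then obtain r where "K \<subseteq> ball 0 r"
    using bounded_subset_ballD[OF compact_imp_bounded] by metis
  moreover have "K \<in> sets lebesgue" using K by (simp add: borel_compact)
  ultimately show "set_integrable lebesgue K f"
    using set_integrable_subset[OF assms] by blast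
qed

text \<open>Allows a Lebesgue measurable function to be exchanged for a Borel representative, before
  and after the composition.\<close>

lemma sharp_norm_cong_AE:
  assumes "f \<in> borel_measurable lebesgue" "g \<in> borel_measurable lebesgue"
    and AE: "AE x in lebesgue. f x = g x"
  shows "sharp_norm p a f = sharp_norm p a g"
proof -
  have avg: "ball_avg f (ball x r) = ball_avg g (ball x r)" for x r
  proof -
    have "(LINT y:ball x r|lebesgue. f y) = (LINT y:ball x r|lebesgue. g y)"
      by (rule set_lebesgue_integral_cong_AE) (use assms AE in auto)
    then show ?thesis by (simp only: ball_avg_def)
  qed
  have "osc_term p a f x r = osc_term p a g x r" for x r
  proof -
    have "(\<integral>\<^sup>+ y. indicator (ball x r) y * ennreal (\<bar>f y - ball_avg f (ball x r)\<bar> powr p) \<partial>lebesgue)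
      = (\<integral>\<^sup>+ y. indicator (ball x r) y * ennreal (\<bar>g y - ball_avg g (ball x r)\<bar> powr p) \<partial>lebesgue)"
      unfolding avg by (rule nn_integral_cong_AE) (use AE in eventually_elim, simp)
    then show ?thesis by (simp only: osc_term_def Let_def)
  qed
  then show ?thesis by (simp only: sharp_norm_def)
qed

text \<open>With \<omega> the volume of the unit ball, |B| powr (a / d) equals \<omega> powr (a / d)
  r powr a, so the two normalisations differ by a factor common to all balls. An infinite integral
  makes both sides false.\<close>

lemma osc_term_le_iff:
  fixes f :: "'a::euclidean_space \<Rightarrow> real"
  assumes f: "f \<in> borel_measurable borel" and r: "0 < r" and p: "1 \<le> p" and N: "0 \<le> N"
  shows "osc_term p a f x r \<le> ereal N \<longleftrightarrow>
    (\<integral>\<^sup>+y. indicator (ball x r) y *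
      ennreal (\<bar>f y - (LINT y:ball x r|lborel. f y) / measure lborel (ball x r)\<bar> powr p) \<partial>lborel)
    \<le> ennreal (measure lborel (ball x r) *
        (N * ball_vol TYPE('a) 1 powr (a / DIM('a)) * r powr a) powr p)"
proof -
  let ?m = "measure lborel (ball x r)"
  have m: "0 < ?m" using r by (rule content_ball_pos)
  have f': "f \<in> borel_measurable lborel" using f by simp
  have "(\<lambda>y. indicator (ball x r) y *\<^sub>R f y) \<in> borel_measurable lborel"
    using f by (auto intro!: borel_measurable_times borel_measurable_indicator)
  then have avg: "ball_avg f (ball x r) = (LINT y:ball x r|lborel. f y) / ?m"
    unfolding ball_avg_def set_lebesgue_integral_def by (simp only: integral_completion measure_completion sets_lborel open_ball borel_open)
  define I where "I = (\<integral>\<^sup>+y. indicator (ball x r) y * ennreal (\<bar>f y - ball_avg f (ball x r)\<bar> powr p) \<partial>lborel)"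
  have mm: "measure lebesgue (ball x r) = ?m" by simp
  have osc: "osc_term p a f x r = (if I = \<infinity> then \<infinity>
      else ereal ((?m powr (- 1 - a * p / DIM('a)) * enn2real I) powr (1 / p)))"
    by (simp only: osc_term_def Let_def I_def nn_integral_completion mm)
  have rhs: "(N * ball_vol TYPE('a) 1 powr (a / DIM('a)) * r powr a) powr p = (N * ?m powr (a / DIM('a))) powr p"
  proof -
    have "(r ^ DIM('a)) powr (a / DIM('a)) = r powr a"
      using r by (simp add: powr_powr flip: powr_realpow)
    then have "?m powr (a / DIM('a)) = r powr a * ball_vol TYPE('a) 1 powr (a / DIM('a))"
      using r ball_vol_pos[where 'a = 'a] by (simp add: measure_ball powr_mult)
    then show ?thesis by (simp add: mult_ac)
  qed
  show ?thesis
  proof (cases "I = \<infinity>")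
    case True
    then show ?thesis unfolding osc I_def avg by (simp add: top_unique)
  next
    case False
    then obtain i where i: "I = ennreal i" "0 \<le> i" by (cases I) auto
    let ?c = "1 + a * p / DIM('a)"
    have mc: "?m powr ?c = ?m * (?m powr (a / DIM('a))) powr p"
      using m by (simp add: powr_add powr_powr)
    have "osc_term p a f x r \<le> ereal N \<longleftrightarrow> (?m powr (- ?c) * i) powr (1 / p) \<le> N"
      unfolding osc using False i by simp
    also have "\<dots> \<longleftrightarrow> ?m powr (- ?c) * i \<le> N powr p"
    proof
      assume "(?m powr (- ?c) * i) powr (1 / p) \<le> N"
      then have "((?m powr (- ?c) * i) powr (1 / p)) powr p \<le> N powr p"
        using p by (intro powr_mono2) auto
      then show "?m powr (- ?c) * i \<le> N powr p" using p i by (simp add: powr_powr)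
    next
      assume "?m powr (- ?c) * i \<le> N powr p"
      then have "(?m powr (- ?c) * i) powr (1 / p) \<le> (N powr p) powr (1 / p)"
        using p i by (intro powr_mono2) auto
      then show "(?m powr (- ?c) * i) powr (1 / p) \<le> N" using p N by (simp add: powr_powr)
    qed
    also have "\<dots> \<longleftrightarrow> i \<le> ?m powr ?c * N powr p"
    proof -
      have "0 < ?m powr ?c" using m by simp
      then show ?thesis unfolding powr_minus by (simp add: field_simps)
    qed
    also have "\<dots> \<longleftrightarrow> i \<le> ?m * (N * ?m powr (a / DIM('a))) powr p"
      unfolding mc using N by (simp add: powr_mult mult_ac)
    also have "\<dots> \<longleftrightarrow> I \<le> ennreal (?m * (N * ?m powr (a / DIM('a))) powr p)"
      unfolding i(1) using m by (subst ennreal_le_iff) auto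
    finally show ?thesis unfolding rhs I_def avg .
  qed
qed

text \<open>The equivalence is applied in one direction to the initial function and in the other to
  the composed one, so the factor from the unit ball cancels.\<close>

lemma bounded_oscillation_iff:
  fixes f :: "'a::euclidean_space \<Rightarrow> real"
  assumes f: "f \<in> borel_measurable borel" "locally_integrable f"
    and p: "1 \<le> p" and a: "0 \<le> a" and N: "0 \<le> N"
  shows "bounded_oscillation f p a (N * ball_vol TYPE('a) 1 powr (a / DIM('a))) \<longleftrightarrow> sharp_norm p a f \<le> ereal N"
proof -
  have int: "set_integrable lborel (ball x r) f" for x r
  proof -
    have "(\<lambda>y. indicator (ball x r) y *\<^sub>R f y) \<in> borel_measurable lborel"
      using f by (auto intro!: borel_measurable_times borel_measurable_indicator)
    from integrable_completion[OF this] show ?thesis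
      using locally_integrable_ball[OF f(2), of x r] by (simp only: set_integrable_def)
  qed
  have "sharp_norm p a f \<le> ereal N \<longleftrightarrow> (\<forall>x r. 0 < r \<longrightarrow> osc_term p a f x r \<le> ereal N)"
    unfolding sharp_norm_def SUP_le_iff by auto
  then show ?thesis
    using f p a N int by (simp add: bounded_oscillation_def osc_term_le_iff[OF f(1) _ p N])
qed

lemma sharp_norm_nonneg: "0 \<le> sharp_norm p a f"
proof -
  have "0 \<le> osc_term p a f 0 1" by (simp add: osc_term_def Let_def)
  also have "\<dots> \<le> sharp_norm p a f"
    unfolding sharp_norm_def by (rule SUP_upper2[of "(0, 1)"]) auto
  finally show ?thesis .
qed

lemma sharp_norm_compose:
  fixes X :: "'a::euclidean_space \<Rightarrow> 'a"
  assumes X: "X \<in> borel_measurable borel" and mp: "distr lborel borel X = lborel"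
    and E: "1 \<le> E" and X_ge: "\<And>x y. dist x y \<le> E * dist (X x) (X y)"
    and X_le: "\<And>x y. dist (X x) (X y) \<le> E * dist x y"
    and n: "E\<^sup>2 \<le> 2 ^ n" "2 ^ n \<le> 2 * E\<^sup>2"
    and p: "1 \<le> p" and a: "0 \<le> a"
    and u: "locally_integrable u" "sharp_norm p a u < \<infinity>"
  shows "locally_integrable (\<lambda>x. u (X x))" (is ?int)
    and "sharp_norm p a (\<lambda>x. u (X x)) \<le>
      ereal (16 * 2 ^ DIM('a) * 4 ^ DIM('a) * 4 powr a * E powr a * (1 + (\<Sum>j<n. (2 powr - a) ^ j))) * sharp_norm p a u" (is ?norm)
proof -
  let ?K = "16 * 2 ^ DIM('a) * 4 ^ DIM('a) * 4 powr a * E powr a * (1 + (\<Sum>j<n. (2 powr - a) ^ j))"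
  let ?\<omega> = "ball_vol TYPE('a) 1 powr (a / DIM('a))"
  have K: "0 \<le> ?K" by (simp add: sum_nonneg)
  have u_meas: "u \<in> borel_measurable lebesgue" by (rule locally_integrable_measurable) fact
  obtain g where g: "g \<in> borel_measurable borel" and AE: "AE x in lborel. u x = g x"
    using completion_ex_borel_measurable_real[OF u_meas] by auto
  have AE': "AE x in lebesgue. u x = g x" using AE by (rule AE_completion)
  have g_leb: "g \<in> borel_measurable lebesgue" using g by (auto intro: measurable_completion)
  have "set_integrable lebesgue (ball 0 r) g" for r
  proof -
    have "set_integrable lebesgue (ball 0 r) u = set_integrable lebesgue (ball 0 r) g"
      by (rule set_integrable_cong_AE[OF u_meas g_leb]) (use AE' in auto)
    then show ?thesis using locally_integrable_ball[OF u(1), of 0 r] by blast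
  qed
  then have g_int: "locally_integrable g" by (rule locally_integrableI_ball)
  have sharp_g: "sharp_norm p a g = sharp_norm p a u"
    by (rule sharp_norm_cong_AE[OF u_meas g_leb AE', symmetric])
  obtain N where N: "sharp_norm p a u = ereal N" "0 \<le> N"
    using u(2) sharp_norm_nonneg[of p a u] by (cases "sharp_norm p a u") auto
  have "bounded_oscillation g p a (N * ?\<omega>)"
    using bounded_oscillation_iff[OF g g_int p a N(2)] sharp_g N(1) by simp
  from bounded_oscillation.compose_osc[OF this X mp E X_ge X_le n]
  have "bounded_oscillation (\<lambda>x. g (X x)) p a (?K * (N * ?\<omega>))" .
  also have "?K * (N * ?\<omega>) = ?K * N * ?\<omega>" by simp
  finally have bo: "bounded_oscillation (\<lambda>x. g (X x)) p a (?K * N * ?\<omega>)" .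
  have gX: "(\<lambda>x. g (X x)) \<in> borel_measurable borel" by (rule measurable_compose[OF X g])
  have gX_leb: "(\<lambda>x. g (X x)) \<in> borel_measurable lebesgue" using gX by (auto intro: measurable_completion)
  have gX_int: "locally_integrable (\<lambda>x. g (X x))"
  proof (rule locally_integrableI_ball)
    fix r
    have "(\<lambda>y. indicator (ball 0 r) y *\<^sub>R g (X y)) \<in> borel_measurable lborel"
      using gX by (auto intro!: borel_measurable_times borel_measurable_indicator)
    from integrable_completion[OF this] show "set_integrable lebesgue (ball 0 r) (\<lambda>x. g (X x))"
      using bounded_oscillation.f_int[OF bo, of 0 r] by (simp only: set_integrable_def)
  qed
  have X': "X \<in> measurable lborel borel" using X by simp
  have "AE x in distr lborel borel X. u x = g x" using AE by (simp only: mp)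
  from AE_completion[OF AE_distrD[OF X' this]]
  have AEX: "AE x in lebesgue. u (X x) = g (X x)" .
  \<comment> \<open>A Lebesgue measurable function composed with a Borel map need not be measurable.
    Here it is, because preimages of null sets under a measure-preserving X are null.\<close>
  have uX_leb: "(\<lambda>x. u (X x)) \<in> borel_measurable lebesgue"
  proof (rule measurable_compose[OF _ u_meas])
    show "X \<in> measurable lebesgue lebesgue"
    proof (rule completion.measurable_completion2)
      show X_leb: "X \<in> measurable lebesgue lborel" using X by (auto intro: measurable_completion)
      have "distr lebesgue lborel X = lborel"
      proof (rule measure_eqI)
        fix A assume "A \<in> sets (distr lebesgue lborel X)"
        then have A: "A \<in> sets borel" by simp
        have XA: "X -` A \<inter> space lborel \<in> sets lborel" by (rule measurable_sets[OF X' A])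
        have "emeasure (distr lebesgue lborel X) A = emeasure lebesgue (X -` A \<inter> space lborel)"
          using A by (subst emeasure_distr[OF X_leb]) auto
        also have "\<dots> = emeasure lborel (X -` A \<inter> space lborel)"
          using XA by (simp del: space_lborel sets_lborel)
        also have "\<dots> = emeasure (distr lborel borel X) A"
          by (rule emeasure_distr[OF X' A, symmetric])
        finally show "emeasure (distr lebesgue lborel X) A = emeasure lborel A" by (simp only: mp)
      qed simp
      then show "null_sets lborel \<subseteq> null_sets (distr lebesgue lborel X)" by simp
    qed
  qed
  show ?int
  proof (rule locally_integrableI_ball)
    fix r
    have "set_integrable lebesgue (ball 0 r) (\<lambda>x. u (X x)) = set_integrable lebesgue (ball 0 r) (\<lambda>x. g (X x))"
      by (rule set_integrable_cong_AE[OF uX_leb gX_leb]) (use AEX in auto)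
    then show "set_integrable lebesgue (ball 0 r) (\<lambda>x. u (X x))"
      using locally_integrable_ball[OF gX_int, of 0 r] by blast
  qed
  have "sharp_norm p a (\<lambda>x. u (X x)) = sharp_norm p a (\<lambda>x. g (X x))"
    by (rule sharp_norm_cong_AE[OF uX_leb gX_leb AEX])
  also have "\<dots> \<le> ereal (?K * N)"
    using bounded_oscillation_iff[OF gX gX_int p a, of "?K * N"] bo K N(2) by simp
  finally show ?norm by (simp add: N(1))
qed

lemma (in lipschitz_flow) sharp_norm_flow:
  assumes div: "divergence_free v" and t: "0 \<le> t" and p: "1 \<le> p" and a: "0 \<le> a"
    and u: "locally_integrable u" "sharp_norm p a u < \<infinity>"
  obtains n where "real n \<le> 1 + 4 * (L * t)"
    and "locally_integrable (\<lambda>x. u (\<phi> t x))"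
    and "sharp_norm p a (\<lambda>x. u (\<phi> t x)) \<le> ereal (16 * 2 ^ DIM('a) * 4 ^ DIM('a) * 4 powr a *
      exp (a * L * t) * (1 + (\<Sum>j<n. (2 powr - a) ^ j))) * sharp_norm p a u"
proof -
  define E where "E = exp (L * t)"
  have Lt: "0 \<le> L * t" using L_nonneg t by simp
  then have E: "1 \<le> E" by (simp add: E_def)
  \<comment> \<open>Rounding log2 (E^2) = 2 L t / ln 2 upwards puts 2^n between E^2 and 2 E^2. The
    crude bound ln 2 >= 1/2 then gives n <= 1 + 4 L t.\<close>
  define n where "n = nat \<lceil>2 * (L * t) / ln 2\<rceil>"
  have ln2: "1 / 2 \<le> ln (2::real)"
    using ln_le_cancel_iff[of "exp (1 / 2)" "2::real"] exp_half_le2 by simp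
  have n_bounds: "2 * (L * t) / ln 2 \<le> real n" "real n \<le> 2 * (L * t) / ln 2 + 1"
  proof -
    have "0 \<le> 2 * (L * t) / ln 2" using Lt by simp
    then show "2 * (L * t) / ln 2 \<le> real n" "real n \<le> 2 * (L * t) / ln 2 + 1"
      unfolding n_def by linarith+
  qed
  have two_n: "2 ^ n = exp (real n * ln (2::real))"
    by (simp flip: powr_realpow add: powr_def)
  have E2: "E\<^sup>2 = exp (2 * (L * t))" by (simp add: E_def exp_double)
  have nE: "E\<^sup>2 \<le> 2 ^ n" unfolding E2 two_n using n_bounds(1) by (simp add: field_simps)
  have nE': "2 ^ n \<le> 2 * E\<^sup>2"
  proof -
    have "real n * ln 2 \<le> 2 * (L * t) + ln 2" using n_bounds(2) by (simp add: field_simps)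
    then have "exp (real n * ln 2) \<le> exp (2 * (L * t) + ln 2)" by simp
    then show ?thesis unfolding E2 two_n by (simp add: exp_add)
  qed
  have "2 * (L * t) / ln 2 \<le> 2 * (L * t) / (1 / 2)"
    using Lt ln2 by (intro divide_left_mono) auto
  then have "real n \<le> 1 + 4 * (L * t)" using n_bounds(2) by simp
  moreover have "E powr a = exp (a * L * t)" by (simp add: E_def powr_def mult_ac)
  ultimately show thesis
    using that sharp_norm_compose[OF flow_measurable[OF t] flow_measure_preserving[OF div t] E _ _ nE nE' p a u]
      flow_dist_le[OF t] flow_dist_ge[OF t] unfolding E_def by metis
qed

text \<open>The factors in front of the initial seminorms are bounded for t in bounded intervals, so
  the estimates contain the local boundedness in time.\<close>

theorem theorem3p1:
  shows
  "(\<exists>C::real. \<forall>(v::'a::euclidean_space \<Rightarrow> 'a) \<phi> (u0::'a \<Rightarrow> real).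
      (\<exists>L. L-lipschitz_on UNIV v) \<longrightarrow> divergence_free v \<longrightarrow> is_flow v \<phi> \<longrightarrow> in_BMO u0 \<longrightarrow>
      (\<forall>t\<ge>0. in_BMO (\<lambda>x. u0 (\<phi> t x)) \<and>
         BMO_norm (\<lambda>x. u0 (\<phi> t x)) \<le> ereal (C * (1 + lip_norm v * t)) * BMO_norm u0))
   \<and>
   (\<forall>p a::real. 1 < p \<longrightarrow> 0 < a \<longrightarrow> a \<le> 1 \<longrightarrow>
     (\<exists>C::real. \<forall>(v::'a \<Rightarrow> 'a) \<phi> (u0::'a \<Rightarrow> real).
      (\<exists>L. L-lipschitz_on UNIV v) \<longrightarrow> divergence_free v \<longrightarrow> is_flow v \<phi> \<longrightarrow> in_Lip p a u0 \<longrightarrow>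
      (\<forall>t\<ge>0. in_Lip p a (\<lambda>x. u0 (\<phi> t x)) \<and>
         Lip_norm p a (\<lambda>x. u0 (\<phi> t x)) \<le> ereal (C * exp (a * lip_norm v * t)) * Lip_norm p a u0)))"
proof (intro conjI allI impI)
  let ?D = "16 * 2 ^ DIM('a) * 4 ^ DIM('a) :: real"
  have finite: "S' < \<infinity>" if "S' \<le> ereal c * S" "S < \<infinity>" "0 \<le> S" for S S' c
    using that by (cases S; cases S') auto
  show "\<exists>C::real. \<forall>(v::'a \<Rightarrow> 'a) \<phi> (u0::'a \<Rightarrow> real).
      (\<exists>L. L-lipschitz_on UNIV v) \<longrightarrow> divergence_free v \<longrightarrow> is_flow v \<phi> \<longrightarrow> in_BMO u0 \<longrightarrow>
      (\<forall>t\<ge>0. in_BMO (\<lambda>x. u0 (\<phi> t x)) \<and>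
         BMO_norm (\<lambda>x. u0 (\<phi> t x)) \<le> ereal (C * (1 + lip_norm v * t)) * BMO_norm u0)"
  \<comment> \<open>For a = 0 every summand is 1, so the factor is D (1 + n), and 1 + n <= 2 + 4 L t
    <= 4 (1 + L t).\<close>
  proof (intro exI[of _ "?D * 4"] allI impI)
    fix v :: "'a \<Rightarrow> 'a" and \<phi> and u :: "'a \<Rightarrow> real" and t :: real
    assume lip: "\<exists>L. L-lipschitz_on UNIV v" and div: "divergence_free v" and flow: "is_flow v \<phi>"
      and u: "in_BMO u" and t: "0 \<le> t"
    interpret lipschitz_flow v \<phi> "lip_norm v"
      by unfold_locales (fact lip_norm_lipschitz[OF lip], fact flow)
    have u': "locally_integrable u" "sharp_norm 1 0 u < \<infinity>" using u by (auto simp: in_BMO_def BMO_norm_def)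
    obtain n where n: "real n \<le> 1 + 4 * (lip_norm v * t)" "locally_integrable (\<lambda>x. u (\<phi> t x))"
      "sharp_norm 1 0 (\<lambda>x. u (\<phi> t x)) \<le> ereal (?D * 4 powr 0 * exp (0 * lip_norm v * t)
        * (1 + (\<Sum>j<n. (2 powr - 0) ^ j))) * sharp_norm 1 0 u"
      by (rule sharp_norm_flow[OF div t _ _ u']) auto
    have "?D * 4 powr 0 * exp (0 * lip_norm v * t) * (1 + (\<Sum>j<n. (2 powr - 0) ^ j)) = ?D * (1 + real n)"
      by simp
    also have "\<dots> \<le> ?D * (4 * (1 + lip_norm v * t))"
      using n(1) by (intro mult_left_mono) auto
    finally have "ereal (?D * 4 powr 0 * exp (0 * lip_norm v * t) * (1 + (\<Sum>j<n. (2 powr - 0) ^ j))) * sharp_norm 1 0 u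
        \<le> ereal (?D * 4 * (1 + lip_norm v * t)) * sharp_norm 1 0 u"
      by (intro ereal_mult_right_mono sharp_norm_nonneg) simp
    with n(3) have le: "sharp_norm 1 0 (\<lambda>x. u (\<phi> t x)) \<le> ereal (?D * 4 * (1 + lip_norm v * t)) * sharp_norm 1 0 u"
      by (rule order_trans)
    show "in_BMO (\<lambda>x. u (\<phi> t x)) \<and> BMO_norm (\<lambda>x. u (\<phi> t x)) \<le> ereal (?D * 4 * (1 + lip_norm v * t)) * BMO_norm u"
      unfolding in_BMO_def BMO_norm_def
      using n(2) le finite[OF le u'(2) sharp_norm_nonneg] by blast
  qed
  fix p a :: real assume p: "1 < p" and a: "0 < a" "a \<le> 1"
  let ?q = "2 powr - a"
  \<comment> \<open>For a > 0 the geometric sum is at most 1 / (1 - q) for every n. This blows up as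
    a tends to 0, which is where the BMO case pays with linear growth in t instead.\<close>
  let ?C = "?D * 4 powr a * (1 + 1 / (1 - ?q))"
  have q: "0 < ?q" "?q < 1" using a by (auto simp: powr_less_one)
  show "\<exists>C::real. \<forall>(v::'a \<Rightarrow> 'a) \<phi> (u0::'a \<Rightarrow> real).
      (\<exists>L. L-lipschitz_on UNIV v) \<longrightarrow> divergence_free v \<longrightarrow> is_flow v \<phi> \<longrightarrow> in_Lip p a u0 \<longrightarrow>
      (\<forall>t\<ge>0. in_Lip p a (\<lambda>x. u0 (\<phi> t x)) \<and>
         Lip_norm p a (\<lambda>x. u0 (\<phi> t x)) \<le> ereal (C * exp (a * lip_norm v * t)) * Lip_norm p a u0)"
  proof (intro exI[of _ ?C] allI impI)
    fix v :: "'a \<Rightarrow> 'a" and \<phi> and u :: "'a \<Rightarrow> real" and t :: real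
    assume lip: "\<exists>L. L-lipschitz_on UNIV v" and div: "divergence_free v" and flow: "is_flow v \<phi>"
      and u: "in_Lip p a u" and t: "0 \<le> t"
    interpret lipschitz_flow v \<phi> "lip_norm v"
      by unfold_locales (fact lip_norm_lipschitz[OF lip], fact flow)
    have u': "locally_integrable u" "sharp_norm p a u < \<infinity>" using u by (auto simp: in_Lip_def Lip_norm_def)
    obtain n where n: "locally_integrable (\<lambda>x. u (\<phi> t x))"
      "sharp_norm p a (\<lambda>x. u (\<phi> t x)) \<le> ereal (?D * 4 powr a * exp (a * lip_norm v * t)
        * (1 + (\<Sum>j<n. ?q ^ j))) * sharp_norm p a u"
      by (rule sharp_norm_flow[OF div t _ _ u']) (use p a in auto)
    have "(\<Sum>j<n. ?q ^ j) = (1 - ?q ^ n) / (1 - ?q)" using a q by (simp add: sum_gp_strict)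
    also have "\<dots> \<le> 1 / (1 - ?q)" using q by (intro divide_right_mono) auto
    finally have "?D * 4 powr a * exp (a * lip_norm v * t) * (1 + (\<Sum>j<n. ?q ^ j))
        \<le> ?D * 4 powr a * exp (a * lip_norm v * t) * (1 + 1 / (1 - ?q))"
      by (intro mult_left_mono add_left_mono) auto
    also have "\<dots> = ?C * exp (a * lip_norm v * t)" by simp
    finally have "ereal (?D * 4 powr a * exp (a * lip_norm v * t) * (1 + (\<Sum>j<n. ?q ^ j))) * sharp_norm p a u
        \<le> ereal (?C * exp (a * lip_norm v * t)) * sharp_norm p a u"
      by (intro ereal_mult_right_mono sharp_norm_nonneg) simp
    with n(2) have le: "sharp_norm p a (\<lambda>x. u (\<phi> t x)) \<le> ereal (?C * exp (a * lip_norm v * t)) * sharp_norm p a u"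
      by (rule order_trans)
    show "in_Lip p a (\<lambda>x. u (\<phi> t x)) \<and> Lip_norm p a (\<lambda>x. u (\<phi> t x)) \<le> ereal (?C * exp (a * lip_norm v * t)) * Lip_norm p a u"
      unfolding in_Lip_def Lip_norm_def
      using n(1) le finite[OF le u'(2) sharp_norm_nonneg] by blast
  qed
qed

end
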